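(* For $n\geq 3$ let $f(\overleftrightarrow{K}_{n})$ be the smallest integer such that every arc-colored $\overleftrightarrow{K}_{n}$ with at least $f(\overleftrightarrow{K}_{n})$ colors contains a rainbow triangle, and let $\mathcal{G}_n$ be the class of arc-colored complete digraphs $D$ of order $n$ such that $c(D)=f(\overleftrightarrow{K}_{n})-1$ and $D$ contains no rainbow triangle. Then: (1) Each $D\in\mathcal{G}_3$ can be decomposed into two arc-disjoint directed triangles $\Delta_1,\Delta_2$, each using exactly $2$ colors, with $C(\Delta_1)\cap C(\Delta_2)=\emptyset$. (2) For each $D\in\mathcal{G}_4$ there is an ordering $v_1,v_2,v_3,v_4$ of $V(D)$ such that $C(v_1v_2)=C(v_2v_3)=C(v_3v_4)=C(v_4v_1)=a$, $C(v_1v_4)=C(v_4v_3)=C(v_3v_2)=C(v_2v_1)=b$, $C(v_1v_3)=c$, $C(v_3v_1)=d$, $C(v_2v_4)=e$, $C(v_4v_2)=f$, where $a,b,c,d,e,f$ are pairwise distinct colors. (3) Each $D\in\mathcal{G}_5$ is of one of the following types: Type I: there is a vertex $v$ such that all arcs incident to $v$ have the same color $c$, $D-v\in\mathcal{G}_4$ and $c\notin C(D-v)$; Type II: $V(D)$ can be partitioned into $\{a_1,a_2\}$ and $\{b_1,b_2,b_3\}$ such that the spanning subdigraph $H$ with $A(H)=\{a_ib_j: i=1,2;\ j=1,2,3\}$ (or with $A(H)=\{b_ja_i: i=1,2;\ j=1,2,3\}$) is rainbow and all arcs of $A(D)\setminus A(H)$ have one and the same color, which does not occur on $A(H)$; Type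 III: $V(D)$ can be partitioned into $\{a_1,a_2\}$ and $\{b_1,b_2,b_3\}$ such that $C(D[\{a_1,a_2\}])=\{a,b\}$, $D[\{b_1,b_2,b_3\}]\in\mathcal{G}_3$ with $C(D[\{b_1,b_2,b_3\}])=\{c,d,e,f\}$, and all arcs between $\{a_1,a_2\}$ and $\{b_1,b_2,b_3\}$ (in both directions) have color $g$, where $a,b,c,d,e,f,g$ are pairwise distinct colors. (4) For each $D\in\mathcal{G}_n$ with $n\geq 6$, $V(D)$ can be partitioned into $\{a_1,\ldots,a_{\lfloor n/2\rfloor}\}$ and $\{b_1,\ldots,b_{\lceil n/2\rceil}\}$ such that the spanning subdigraph $H$ with $A(H)=\{a_ib_j: 1\le i\le\lfloor n/2\rfloor,\ 1\le j\le\lceil n/2\rceil\}$ or with $A(H)=\{b_ja_i: 1\le i\le\lfloor n/2\rfloor,\ 1\le j\le\lceil n/2\rceil\}$ is rainbow and all arcs in $A(D)\setminus A(H)$ have one and the same color, which does not occur on $A(H)$.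
   Context: All digraphs are finite, without loops or multiple arcs (opposite arcs $xy,yx$ allowed). $\overleftrightarrow{K}_{n}$ is the complete digraph on $n$ vertices (both arcs between every pair of vertices). An arc-coloring is any map $C:A(D)\to\mathbb{N}$; $C(D)$ is the set and $c(D)$ the number of colors used on $A(D)$. A digraph is rainbow if its arcs have pairwise distinct colors; a rainbow triangle is a rainbow directed cycle of length 3. $D[S]$ is the subdigraph induced by $S$, and $D-v$ is obtained by deleting vertex $v$. *)

theory Defs
  imports Main
begin

text \<open>An arc-colored complete digraph on a finite vertex set V is represented by V together
  with a colour function C; only the values C x y with x, y in V and x \<noteq> y (the arcs) matter.\<close>

definition arcs :: "'a set \<Rightarrow> ('a \<times> 'a) set" where
  "arcs V = {(x, y). x \<in> V \<and> y \<in> V \<and> x \<noteq> y}"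

definition colors :: "'a set \<Rightarrow> ('a \<Rightarrow> 'a \<Rightarrow> nat) \<Rightarrow> nat set" where
  "colors V C = (\<lambda>(x, y). C x y) ` arcs V"

definition has_rainbow_triangle :: "'a set \<Rightarrow> ('a \<Rightarrow> 'a \<Rightarrow> nat) \<Rightarrow> bool" where
  "has_rainbow_triangle V C \<longleftrightarrow>
     (\<exists>x y z. x \<in> V \<and> y \<in> V \<and> z \<in> V \<and> x \<noteq> y \<and> y \<noteq> z \<and> x \<noteq> z \<and>
        C x y \<noteq> C y z \<and> C y z \<noteq> C z x \<and> C x y \<noteq> C z x)"

definition rainbow :: "('a \<times> 'a) set \<Rightarrow> ('a \<Rightarrow> 'a \<Rightarrow> nat) \<Rightarrow> bool" where
  "rainbow H C \<longleftrightarrow> inj_on (\<lambda>(x, y). C x y) H"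

text \<open>f(K_n), computed on the canonical vertex set {0..<n} (invariant under relabelling).\<close>
definition f_K :: "nat \<Rightarrow> nat" where
  "f_K n = (LEAST k. \<forall>C :: nat \<Rightarrow> nat \<Rightarrow> nat.
              k \<le> card (colors {..<n} C) \<longrightarrow> has_rainbow_triangle {..<n} C)"

definition in_G :: "nat \<Rightarrow> 'a set \<Rightarrow> ('a \<Rightarrow> 'a \<Rightarrow> nat) \<Rightarrow> bool" where
  "in_G n V C \<longleftrightarrow> finite V \<and> card V = n \<and> card (colors V C) = f_K n - 1 \<and>
                    \<not> has_rainbow_triangle V C"

definition bip_structure :: "'a set \<Rightarrow> 'a set \<Rightarrow> 'a set \<Rightarrow> ('a \<Rightarrow> 'a \<Rightarrow> nat) \<Rightarrow> bool" where
  "bip_structure V A B C \<longleftrightarrow>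
     (\<exists>H. (H = A \<times> B \<or> H = B \<times> A) \<and> rainbow H C \<and>
        (\<exists>c. (\<forall>(x, y) \<in> arcs V - H. C x y = c) \<and> c \<notin> (\<lambda>(x, y). C x y) ` H))"

end

theory Submission
  imports Defs
begin

text \<open>
  Call a colour saturated by \<open>v\<close> if it occurs only on arcs at \<open>v\<close>; deleting \<open>v\<close> loses exactly these colours.
  A saturated out-arc \<open>v x\<close> and a saturated in-arc \<open>y v\<close> with \<open>x \<noteq> y\<close> have the same colour, since
  otherwise \<open>v x y\<close> is rainbow. Hence three saturated colours at \<open>v\<close> all leave \<open>v\<close> or all enter \<open>v\<close>, and
  then the triangles at \<open>v\<close> determine most of the remaining colours. It follows that some vertex saturates
  at most \<open>n div 2\<close> colours, which bounds the number of colours inductively; in the case of equality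
  that vertex saturates exactly \<open>n div 2\<close> colours and can only be attached to the extremal colouring on
  \<open>n - 1\<close> vertices in one way. For \<open>n = 5\<close>, either a vertex can be deleted leaving six colours (Type I), or
  every vertex saturates two colours; double counting then yields three colours each living on a single
  pair of vertices, two of these pairs meet, and a finite case analysis gives Types II and III. Reversing
  all arcs exchanges out-arcs and in-arcs.
\<close>

section \<open>Colours confined to one vertex\<close>

definition rev_col :: "('a \<Rightarrow> 'a \<Rightarrow> nat) \<Rightarrow> 'a \<Rightarrow> 'a \<Rightarrow> nat" where
  "rev_col C = (\<lambda>x y. C y x)"

definition sat :: "'a set \<Rightarrow> ('a \<Rightarrow> 'a \<Rightarrow> nat) \<Rightarrow> 'a \<Rightarrow> nat set" where
  "sat V C v = colors V C - colors (V - {v}) C"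

lemma rev_col_apply [simp]: "rev_col C x y = C y x"
  by (simp add: rev_col_def)

lemma colors_iff: "c \<in> colors V C \<longleftrightarrow> (\<exists>x\<in>V. \<exists>y\<in>V. x \<noteq> y \<and> c = C x y)"
  by (auto simp: colors_def arcs_def)

lemma colorsI: "x \<in> V \<Longrightarrow> y \<in> V \<Longrightarrow> x \<noteq> y \<Longrightarrow> C x y \<in> colors V C"
  by (auto simp: colors_iff)

lemma colors_rev [simp]: "colors V (rev_col C) = colors V C"
  by (rule set_eqI) (simp only: colors_iff rev_col_apply, metis)

lemma sat_rev [simp]: "sat V (rev_col C) v = sat V C v"
  by (simp add: sat_def)

lemma has_rainbow_triangle_rev [simp]:
  "has_rainbow_triangle V (rev_col C) \<longleftrightarrow> has_rainbow_triangle V C"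
proof -
  have "has_rainbow_triangle V C" if "has_rainbow_triangle V (rev_col C)" for C :: "'a \<Rightarrow> 'a \<Rightarrow> nat"
  proof -
    from that obtain x y z where "x \<in> V" "y \<in> V" "z \<in> V" "x \<noteq> y" "y \<noteq> z" "x \<noteq> z"
      "C y x \<noteq> C z y" "C z y \<noteq> C x z" "C y x \<noteq> C x z"
      unfolding has_rainbow_triangle_def rev_col_apply by blast
    then show ?thesis unfolding has_rainbow_triangle_def
      by (intro exI[of _ z] exI[of _ y] exI[of _ x]) auto
  qed
  from this[of C] this[of "rev_col C"] show ?thesis by (auto simp: rev_col_def)
qed

lemma finite_colors: "finite V \<Longrightarrow> finite (colors V C)"
proof -
  assume "finite V"
  moreover have "arcs V \<subseteq> V \<times> V" by (auto simp: arcs_def)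
  ultimately have "finite (arcs V)" by (meson finite_SigmaI finite_subset)
  then show ?thesis by (simp add: colors_def)
qed

lemma colors_mono: "U \<subseteq> V \<Longrightarrow> colors U C \<subseteq> colors V C"
  unfolding colors_iff subset_iff by metis

lemma finite_sat: "finite V \<Longrightarrow> finite (sat V C v)"
  by (simp add: sat_def finite_colors)

lemma card_colors_delete:
  assumes "finite V"
  shows "card (colors V C) = card (colors (V - {v}) C) + card (sat V C v)"
proof -
  have "colors V C = colors (V - {v}) C \<union> sat V C v"
    using colors_mono[of "V - {v}" V C] by (auto simp: sat_def)
  moreover have "colors (V - {v}) C \<inter> sat V C v = {}" by (auto simp: sat_def)
  ultimately show ?thesis
    using card_Un_disjoint finite_colors finite_sat assms by (metis finite_Diff)
qed

lemma no_rainbowD: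
  assumes "\<not> has_rainbow_triangle V C" "x \<in> V" "y \<in> V" "z \<in> V" "x \<noteq> y" "y \<noteq> z" "x \<noteq> z"
  shows "C x y = C y z \<or> C y z = C z x \<or> C x y = C z x"
  using assms unfolding has_rainbow_triangle_def by blast

lemma no_rainbow_mono:
  assumes "\<not> has_rainbow_triangle V C" "U \<subseteq> V"
  shows "\<not> has_rainbow_triangle U C"
  using assms unfolding has_rainbow_triangle_def by blast

lemma sat_neq:
  assumes "c \<in> sat V C v" "x \<in> V" "y \<in> V" "x \<noteq> y" "x \<noteq> v" "y \<noteq> v"
  shows "C x y \<noteq> c"
  using assms colorsI[of x "V - {v}" y C] by (auto simp: sat_def)

lemma sat_arc:
  assumes "c \<in> sat V C v"
  obtains x where "x \<in> V" "x \<noteq> v" "v \<in> V" "c = C v x \<or> c = C x v"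
proof -
  from assms obtain x y where xy: "x \<in> V" "y \<in> V" "x \<noteq> y" "c = C x y"
    unfolding sat_def Diff_iff colors_iff by blast
  have "x = v \<or> y = v" using sat_neq[OF assms xy(1-3)] xy(4) by metis
  then show ?thesis using that xy by metis
qed

lemma sat_out_in_eq:
  assumes "\<not> has_rainbow_triangle V C" "v \<in> V" "x \<in> V" "y \<in> V" "x \<noteq> y" "x \<noteq> v" "y \<noteq> v"
    and "C v x \<in> sat V C v" "C y v \<in> sat V C v"
  shows "C v x = C y v"
  using no_rainbowD[OF assms(1), of v x y] sat_neq[OF assms(8), of x y]
    sat_neq[OF assms(9), of x y] assms(2-7) by metis

text \<open>By \<open>sat_out_in_eq\<close> a saturated in-arc from \<open>w\<close> would have both
  colours \<open>C v x\<close> and \<open>C v y\<close>, so \<open>C w v\<close> is not saturated.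
  In the triangle \<open>v x w\<close> the colour of \<open>v x\<close> then differs from the other
  two, which must agree.\<close>

lemma sat_two_out:
  assumes "\<not> has_rainbow_triangle V C" "v \<in> V" "x \<in> V" "y \<in> V" "w \<in> V"
    and "x \<noteq> v" "y \<noteq> v" "w \<noteq> v" "w \<noteq> x" "w \<noteq> y"
    and s: "C v x \<in> sat V C v" "C v y \<in> sat V C v" and ne: "C v x \<noteq> C v y"
  shows "C x w = C w v"
proof -
  have "C w v \<notin> sat V C v"
    using sat_out_in_eq[OF assms(1), of v x w] sat_out_in_eq[OF assms(1), of v y w] assms by metis
  then have "C v x \<noteq> C w v" using s by metis
  moreover have "C x w \<noteq> C v x" using sat_neq[OF s(1), of x w] assms by metis
  ultimately show ?thesis using no_rainbowD[OF assms(1), of v x w] assms by metis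
qed

text \<open>The in-arc counterpart is written \<open>out_sat V (rev_col C) v\<close>, so every
  statement about out-arcs yields its mirror image. The two sets may overlap, since a saturated
  colour can occur in both directions.\<close>

definition out_sat :: "'a set \<Rightarrow> ('a \<Rightarrow> 'a \<Rightarrow> nat) \<Rightarrow> 'a \<Rightarrow> nat set" where
  "out_sat V C v = {C v x | x. x \<in> V \<and> x \<noteq> v} \<inter> sat V C v"

lemma out_satE:
  assumes "c \<in> out_sat V C v"
  obtains x where "x \<in> V" "x \<noteq> v" "c = C v x" "c \<in> sat V C v"
  using assms by (auto simp: out_sat_def)

lemma sat_eq_out_in: "v \<in> V \<Longrightarrow> sat V C v = out_sat V C v \<union> out_sat V (rev_col C) v"
proof
  show "sat V C v \<subseteq> out_sat V C v \<union> out_sat V (rev_col C) v"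
  proof
    fix c assume c: "c \<in> sat V C v"
    then obtain x where "x \<in> V" "x \<noteq> v" "v \<in> V" "c = C v x \<or> c = C x v" using sat_arc by metis
    then show "c \<in> out_sat V C v \<union> out_sat V (rev_col C) v" using c by (auto simp: out_sat_def)
  qed
qed (auto simp: out_sat_def)

section \<open>Directions of the saturated colours at a vertex\<close>

lemma ex_two_elements: "2 \<le> card A \<Longrightarrow> \<exists>a b. a \<in> A \<and> b \<in> A \<and> a \<noteq> b"
  by (metis card.empty card_1_singleton_iff card_gt_0_iff is_singletonI' is_singleton_altdef
      not_less_eq_eq numeral_2_eq_2 One_nat_def le_0_eq nat.simps(3) not_numeral_le_zero)

text \<open>Out-arcs with different colours have different heads, so the tail \<open>y\<close> of a
  saturated in-arc misses one of the two heads, and \<open>sat_out_in_eq\<close> gives the in-arc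
  the colour of that out-arc.\<close>

lemma in_sat_subset_out:
  assumes nr: "\<not> has_rainbow_triangle V C" and v: "v \<in> V" and two: "2 \<le> card (out_sat V C v)"
  shows "out_sat V (rev_col C) v \<subseteq> out_sat V C v"
proof
  fix c assume c: "c \<in> out_sat V (rev_col C) v"
  then obtain y where y: "y \<in> V" "y \<noteq> v" "c = C y v" "c \<in> sat V C v"
    using out_satE[OF c] by auto
  obtain a b where ab: "a \<in> out_sat V C v" "b \<in> out_sat V C v" "a \<noteq> b"
    using ex_two_elements[OF two] by blast
  obtain x1 where x1: "x1 \<in> V" "x1 \<noteq> v" "a = C v x1" "a \<in> sat V C v" using out_satE[OF ab(1)] .
  obtain x2 where x2: "x2 \<in> V" "x2 \<noteq> v" "b = C v x2" "b \<in> sat V C v" using out_satE[OF ab(2)] .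
  have "x1 \<noteq> y \<or> x2 \<noteq> y" using ab x1 x2 by metis
  then have "c = a \<or> c = b"
    using sat_out_in_eq[OF nr v x1(1) y(1)] sat_out_in_eq[OF nr v x2(1) y(1)] x1 x2 y by metis
  then show "c \<in> out_sat V C v" using ab by metis
qed

text \<open>One direction carries at least two of the colours and absorbs the other by
  \<open>in_sat_subset_out\<close>. The alternatives are not exclusive; \<open>ex_small_sat\<close>
  has to rule out the overlap.\<close>

lemma sat_source_or_sink:
  assumes nr: "\<not> has_rainbow_triangle V C" and v: "v \<in> V" and fin: "finite V"
    and three: "3 \<le> card (sat V C v)"
  shows "sat V C v = out_sat V C v \<or> sat V C v = out_sat V (rev_col C) v"
proof -
  have nr': "\<not> has_rainbow_triangle V (rev_col C)" using nr by simp
  have rr: "rev_col (rev_col C) = C" by (simp add: rev_col_def)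
  have "card (sat V C v) \<le> card (out_sat V C v) + card (out_sat V (rev_col C) v)"
    using sat_eq_out_in[OF v, of C] card_Un_le by metis
  then have "2 \<le> card (out_sat V C v) \<or> 2 \<le> card (out_sat V (rev_col C) v)" using three by linarith
  then show ?thesis
    using in_sat_subset_out[OF nr v] in_sat_subset_out[OF nr' v] sat_eq_out_in[OF v, of C]
    unfolding rr by blast
qed

text \<open>If neither direction carries two colours, one saturated colour leaves \<open>v\<close>
  and a different one enters it, and \<open>sat_out_in_eq\<close> forces both onto the same pair
  \<open>v\<close>, \<open>x\<close>. The triangles \<open>v x w\<close> and \<open>v w x\<close>
  then make every arc at \<open>v\<close> copy an arc at \<open>x\<close>.\<close>

lemma sat_two_cases:
  assumes nr: "\<not> has_rainbow_triangle V C" and v: "v \<in> V" and fin: "finite V"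
    and two: "2 \<le> card (sat V C v)"
  shows "2 \<le> card (out_sat V C v) \<or> 2 \<le> card (out_sat V (rev_col C) v) \<or>
    (\<exists>x\<in>V. x \<noteq> v \<and> C v x \<in> sat V C v \<and> C x v \<in> sat V C v \<and> C v x \<noteq> C x v \<and>
       (\<forall>w\<in>V. w \<noteq> v \<longrightarrow> w \<noteq> x \<longrightarrow> C w v = C x w \<and> C v w = C w x))"
proof (cases "2 \<le> card (out_sat V C v) \<or> 2 \<le> card (out_sat V (rev_col C) v)")
  case False
  obtain a b where ab: "a \<in> sat V C v" "b \<in> sat V C v" "a \<noteq> b"
    using ex_two_elements[OF two] by blast
  have no_two: "\<not> (a' \<in> S \<and> b' \<in> S)"
    if "S = out_sat V C v \<or> S = out_sat V (rev_col C) v" "a' \<noteq> b'" for S a' b'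
  proof
    assume "a' \<in> S \<and> b' \<in> S"
    moreover have "finite S" using that(1) finite_sat[OF fin, of C v]
      by (auto simp: out_sat_def)
    ultimately have "card {a', b'} \<le> card S" by (intro card_mono) auto
    then show False using False that by auto
  qed
  have "\<exists>a b. a \<in> out_sat V C v \<and> b \<in> out_sat V (rev_col C) v \<and> a \<noteq> b"
    using ab no_two sat_eq_out_in[OF v, of C] by (metis Un_iff)
  then obtain p q where pq: "p \<in> out_sat V C v" "q \<in> out_sat V (rev_col C) v" "p \<noteq> q" by blast
  obtain x where x: "x \<in> V" "x \<noteq> v" "p = C v x" "p \<in> sat V C v" using out_satE[OF pq(1)] .
  obtain y where y: "y \<in> V" "y \<noteq> v" "q = C y v" "q \<in> sat V C v"
    using out_satE[OF pq(2)] by auto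
  have xy: "x = y" using sat_out_in_eq[OF nr v x(1) y(1)] x y pq(3) by metis
  have "C w v = C x w \<and> C v w = C w x" if w: "w \<in> V" "w \<noteq> v" "w \<noteq> x" for w
  proof -
    \<comment> \<open>Colour \<open>p\<close> on \<open>w v\<close> would give two saturated
      in-colours \<open>p\<close> and \<open>q\<close>; colour \<open>q\<close> would equal
      \<open>C v x = p\<close> by \<open>sat_out_in_eq\<close>. The arc \<open>v w\<close> is
      treated symmetrically.\<close>
    have "C w v \<noteq> p" "C w v \<noteq> q"
      using sat_out_in_eq[OF nr v x(1) w(1)] x w y pq(3) no_two[of "out_sat V (rev_col C) v" p q] pq(2)
      by (auto simp: out_sat_def)
    moreover have "C v w \<noteq> p" "C v w \<noteq> q"
      using sat_out_in_eq[OF nr v w(1) y(1)] x w y pq(3) xy no_two[of "out_sat V C v" p q] pq(1)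
      by (auto simp: out_sat_def)
    ultimately show ?thesis
      using no_rainbowD[OF nr, of v x w] no_rainbowD[OF nr, of v w x] x y xy v w
        sat_neq[OF x(4), of x w] sat_neq[OF y(4), of x w]
        sat_neq[OF x(4), of w x] sat_neq[OF y(4), of w x] by metis
  qed
  then show ?thesis using x y xy pq(3) by metis
qed auto

text \<open>One head is selected for each colour, so that counting colours becomes counting
  vertices.\<close>

lemma out_sat_targets:
  assumes "\<not> has_rainbow_triangle V C" "v \<in> V" "finite V"
  obtains X where "X \<subseteq> V" "v \<notin> X" "inj_on (C v) X" "C v ` X = out_sat V C v" "finite X"
    "card X = card (out_sat V C v)"
proof -
  have "out_sat V C v \<subseteq> C v ` (V - {v})" by (auto simp: out_sat_def)
  then obtain X where X: "X \<subseteq> V - {v}" "out_sat V C v = C v ` X" "inj_on (C v) X"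
    using subset_image_inj by metis
  then have "finite X" using assms(3) finite_subset by blast
  then show ?thesis using that[of X] X card_image[OF X(3)] by auto
qed

text \<open>Otherwise a third target \<open>z\<close> outside \<open>{x, y}\<close> exists, and
  \<open>sat_two_out\<close> gives both \<open>x y\<close> and \<open>z y\<close> the colour of
  \<open>y v\<close>; the colour then occurs away from \<open>x\<close>.\<close>

lemma target_not_source:
  assumes nr: "\<not> has_rainbow_triangle V C" and v: "v \<in> V"
    and X: "X \<subseteq> V" "v \<notin> X" "inj_on (C v) X" "C v ` X \<subseteq> sat V C v" "3 \<le> card X" and x: "x \<in> X"
    and y: "y \<in> V" "y \<noteq> x" "C x y \<in> sat V C x"
  shows "y = v"
proof (rule ccontr)
  assume yv: "y \<noteq> v"
  have finX: "finite X" using X(5) card.infinite by fastforce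
  have "card (X - {x, y}) > 0"
  proof -
    have "card X - card {x, y} \<le> card (X - {x, y})" by (rule diff_card_le_card_Diff) simp
    moreover have "card {x, y} \<le> 2" by (simp add: card_insert_if)
    ultimately show ?thesis using X(5) by linarith
  qed
  then obtain z where z: "z \<in> X" "z \<noteq> x" "z \<noteq> y" by (metis Diff_iff card_gt_0_iff ex_in_conv insertCI)
  have ne: "C v x \<noteq> C v z" using X(3) x z by (metis inj_onD)
  have "C x y = C y v" "C z y = C y v"
    using sat_two_out[OF nr v, of x z y] sat_two_out[OF nr v, of z x y] ne X x z y yv by auto
  then show False using sat_neq[OF y(3), of z y] X x y z by auto
qed

text \<open>By \<open>target_not_source\<close> a saturated out-arc of a target can only return to
  \<open>v\<close>, so it contributes at most one colour. With at least three saturated colours the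
  target cannot be a source, hence it is a sink.\<close>

lemma out_sat_ge3_targets_sink:
  assumes nr: "\<not> has_rainbow_triangle V C" and v: "v \<in> V" and fin: "finite V"
    and big: "\<And>u. u \<in> V \<Longrightarrow> 3 \<le> card (sat V C u)"
    and src: "sat V C v = out_sat V C v"
  shows "card (sat V C v) \<le> card {u \<in> V. sat V C u = out_sat V (rev_col C) u}"
proof -
  obtain X where X: "X \<subseteq> V" "v \<notin> X" "inj_on (C v) X" "C v ` X = out_sat V C v" "finite X"
    "card X = card (out_sat V C v)" using out_sat_targets[OF nr v fin] .
  have "X \<subseteq> {u \<in> V. sat V C u = out_sat V (rev_col C) u}"
  proof
    fix x assume x: "x \<in> X"
    then have xV: "x \<in> V" using X by auto
    have "sat V C x \<noteq> out_sat V C x"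
    proof
      assume eq: "sat V C x = out_sat V C x"
      have "out_sat V C x \<subseteq> {C x v}"
      proof
        fix c assume "c \<in> out_sat V C x"
        then obtain y where y: "y \<in> V" "y \<noteq> x" "c = C x y" "c \<in> sat V C x" using out_satE by metis
        have "y = v"
          using target_not_source[OF nr v X(1-3) _ _ x, of y] X(4,6) big[OF v] src y by auto
        then show "c \<in> {C x v}" using y by simp
      qed
      then have "card (out_sat V C x) \<le> 1" by (metis card_mono finite.emptyI finite.insertI is_singletonI is_singleton_altdef)
      then show False using big[OF xV] eq by simp
    qed
    then show "x \<in> {u \<in> V. sat V C u = out_sat V (rev_col C) u}"
      using sat_source_or_sink[OF nr xV fin big[OF xV]] xV by auto
  qed
  then have "card X \<le> card {u \<in> V. sat V C u = out_sat V (rev_col C) u}"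
    using fin by (intro card_mono) auto
  then show ?thesis using X src by simp
qed

text \<open>Otherwise every vertex is a pure source or a pure sink of its saturated colours. The targets
  of a source are sinks and the origins at a sink are sources, so each kind makes up more than half
  of the vertices.\<close>

lemma ex_small_sat:
  assumes nr: "\<not> has_rainbow_triangle V C" and fin: "finite V" and n: "4 \<le> card V"
  obtains v where "v \<in> V" "card (sat V C v) \<le> card V div 2"
proof (rule ccontr)
  assume "\<not> thesis"
  then have big: "card V div 2 < card (sat V C u)" if "u \<in> V" for u
    using \<open>\<not> thesis\<close> that not_le \<open>\<And>v. v \<in> V \<Longrightarrow> card (sat V C v) \<le> card V div 2 \<Longrightarrow> thesis\<close> by blast
  have big3: "3 \<le> card (sat V C u)" if "u \<in> V" for u using big[OF that] n by linarith
  have nr': "\<not> has_rainbow_triangle V (rev_col C)" using nr by simp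
  have rr: "rev_col (rev_col C) = C" by (simp add: rev_col_def)
  define S where "S = {u \<in> V. sat V C u = out_sat V C u}"
  define T where "T = {u \<in> V. sat V C u = out_sat V (rev_col C) u}"
  have cov: "u \<in> S \<or> u \<in> T" if "u \<in> V" for u
    using sat_source_or_sink[OF nr that fin big3[OF that]] that by (auto simp: S_def T_def)
  have S1: "card V div 2 < card T" if "u \<in> S" for u
    using out_sat_ge3_targets_sink[OF nr _ fin big3, of u] big[of u] that by (auto simp: S_def T_def)
  have T1: "card V div 2 < card S" if "u \<in> T" for u
    using out_sat_ge3_targets_sink[OF nr' _ fin, of u] big[of u] big3 that
    by (auto simp: S_def T_def rr)
  have fS: "finite S" "finite T" using fin by (auto simp: S_def T_def)
  obtain u where "u \<in> V" using n by fastforce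
  then have "card V div 2 < card S \<and> card V div 2 < card T"
    using cov S1 T1 by (metis card_gt_0_iff ex_in_conv gr_implies_not_zero not_gr_zero)
  \<comment> \<open>Both sizes are at least \<open>card V div 2 + 1\<close>, so the rounding does no
    harm and \<open>S\<close> and \<open>T\<close> must meet.\<close>
  then have "card V < card S + card T" by linarith
  also have "\<dots> = card (S \<union> T) + card (S \<inter> T)" using card_Un_Int[OF fS] by simp
  also have "S \<union> T = V" using cov by (auto simp: S_def T_def)
  finally have "S \<inter> T \<noteq> {}" by auto
  then obtain v where v: "v \<in> V" "sat V C v = out_sat V C v" "sat V C v = out_sat V (rev_col C) v"
    by (auto simp: S_def T_def)
  obtain X where X: "X \<subseteq> V" "v \<notin> X" "inj_on (C v) X" "C v ` X = out_sat V C v" "finite X"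
    "card X = card (out_sat V C v)" using out_sat_targets[OF nr v(1) fin] .
  \<comment> \<open>A saturated in-arc from \<open>y\<close> imposes its colour on the saturated
    out-arcs to all targets other than \<open>y\<close>. At least two such targets remain, although
    their colours are distinct.\<close>
  obtain c where c: "c \<in> out_sat V (rev_col C) v" using big3[OF v(1)] v(3) by fastforce
  obtain y where y: "y \<in> V" "y \<noteq> v" "c = C y v" "c \<in> sat V C v"
    using out_satE[OF c] by auto
  have "2 \<le> card (X - {y})"
    using X(6) big3[OF v(1)] v(2) diff_card_le_card_Diff[of "{y}" X] by simp
  then obtain a b where ab: "a \<in> X - {y}" "b \<in> X - {y}" "a \<noteq> b" using ex_two_elements by metis
  have "C v a = c" "C v b = c"
    using sat_out_in_eq[OF nr v(1), of a y] sat_out_in_eq[OF nr v(1), of b y] ab X y v by auto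
  then show False using ab X(3) by (metis DiffD1 inj_onD)
qed

section \<open>Three and four vertices\<close>

lemma colors_triple:
  assumes "x \<noteq> y" "y \<noteq> z" "x \<noteq> z"
  shows "colors {x, y, z} C = {C x y, C y z, C z x} \<union> {C x z, C z y, C y x}"
  using assms unfolding colors_def arcs_def by (auto simp: image_iff)

lemma card_triple_le_2:
  assumes "p = q \<or> q = r \<or> p = (r :: nat)"
  shows "card {p, q, r} \<le> 2"
  using assms by (auto simp: card_insert_if)

text \<open>The six arcs split into the two orientations of the triangle, each with at most two
  colours; four colours leave no slack in the union.\<close>

lemma three_vertices:
  assumes nr: "\<not> has_rainbow_triangle {x, y, z} C" and ne: "x \<noteq> y" "y \<noteq> z" "x \<noteq> z"
  shows "card (colors {x, y, z} C) \<le> 4"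
    and "4 \<le> card (colors {x, y, z} C) \<Longrightarrow>
      card {C x y, C y z, C z x} = 2 \<and> card {C x z, C z y, C y x} = 2 \<and>
      {C x y, C y z, C z x} \<inter> {C x z, C z y, C y x} = {}"
proof -
  let ?P = "{C x y, C y z, C z x}" and ?Q = "{C x z, C z y, C y x}"
  have P: "card ?P \<le> 2" using no_rainbowD[OF nr, of x y z] ne by (intro card_triple_le_2) auto
  have Q: "card ?Q \<le> 2" using no_rainbowD[OF nr, of x z y] ne by (intro card_triple_le_2) auto
  have PQ: "card (?P \<union> ?Q) + card (?P \<inter> ?Q) = card ?P + card ?Q"
    by (rule card_Un_Int[symmetric]) auto
  show "card (colors {x, y, z} C) \<le> 4" using P Q PQ colors_triple[OF ne, of C] by simp
  assume "4 \<le> card (colors {x, y, z} C)"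
  then have "4 \<le> card (?P \<union> ?Q)" using colors_triple[OF ne, of C] by simp
  then have "card ?P = 2 \<and> card ?Q = 2 \<and> card (?P \<inter> ?Q) = 0"
    using P Q PQ by (intro conjI) linarith+
  then show "card ?P = 2 \<and> card ?Q = 2 \<and> ?P \<inter> ?Q = {}" by simp
qed

lemma card_colors_three:
  assumes "\<not> has_rainbow_triangle V C" "card V = 3"
  shows "card (colors V C) \<le> 4"
  using assms three_vertices(1) by (metis card_3_iff)

text \<open>The two arcs compared lie in opposite orientations of the triangle, whose colour sets
  are disjoint. This contradicts what \<open>two_out_common\<close> yields.\<close>

lemma three_vertices_separate:
  assumes "\<not> has_rainbow_triangle V C" "card V = 3" "4 \<le> card (colors V C)"
    and "x \<in> V" "y \<in> V" "w \<in> V" "x \<noteq> y" "w \<noteq> x" "w \<noteq> y"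
  shows "C x w \<noteq> C y w" "C w x \<noteq> C w y"
proof -
  have "finite V" using assms(2) card.infinite by fastforce
  then have V: "V = {x, y, w}"
    using assms card_subset_eq[of V "{x, y, w}"] by auto
  have "{C x y, C y w, C w x} \<inter> {C x w, C w y, C y x} = {}"
    using three_vertices(2)[of x y w C] assms unfolding V by auto
  then show "C x w \<noteq> C y w" "C w x \<noteq> C w y" by auto
qed

text \<open>By \<open>sat_two_out\<close> both colours equal \<open>C w v\<close>. The conclusion no
  longer mentions arcs at \<open>v\<close>, so it can be tested against the extremal colouring of
  \<open>V - {v}\<close>.\<close>

lemma two_out_common:
  assumes nr: "\<not> has_rainbow_triangle V C" and v: "v \<in> V" and two: "2 \<le> card (out_sat V C v)"
  obtains x y where "x \<in> V - {v}" "y \<in> V - {v}" "x \<noteq> y"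
    "\<And>w. w \<in> V - {v} \<Longrightarrow> w \<noteq> x \<Longrightarrow> w \<noteq> y \<Longrightarrow> C x w = C y w"
proof -
  obtain a b where ab: "a \<in> out_sat V C v" "b \<in> out_sat V C v" "a \<noteq> b"
    using ex_two_elements[OF two] by blast
  obtain x where x: "x \<in> V" "x \<noteq> v" "a = C v x" "a \<in> sat V C v" using out_satE[OF ab(1)] .
  obtain y where y: "y \<in> V" "y \<noteq> v" "b = C v y" "b \<in> sat V C v" using out_satE[OF ab(2)] .
  show ?thesis
  proof (rule that[of x y])
    fix w assume w: "w \<in> V - {v}" "w \<noteq> x" "w \<noteq> y"
    have "C x w = C w v" "C y w = C w v"
      using sat_two_out[OF nr v, of x y w] sat_two_out[OF nr v, of y x w] x y w ab(3) by auto
    then show "C x w = C y w" by simp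
  qed (use x y ab in auto)
qed

text \<open>Two opposite Hamiltonian cycles are monochromatic, and the four diagonal arcs carry the
  four remaining colours.\<close>

definition four_cycle_structure :: "('a \<Rightarrow> 'a \<Rightarrow> nat) \<Rightarrow> 'a \<Rightarrow> 'a \<Rightarrow> 'a \<Rightarrow> 'a \<Rightarrow> bool" where
  "four_cycle_structure C v1 v2 v3 v4 \<longleftrightarrow>
     distinct [C v1 v2, C v2 v1, C v1 v3, C v3 v1, C v2 v4, C v4 v2] \<and>
     C v2 v3 = C v1 v2 \<and> C v3 v4 = C v1 v2 \<and> C v4 v1 = C v1 v2 \<and>
     C v1 v4 = C v2 v1 \<and> C v4 v3 = C v2 v1 \<and> C v3 v2 = C v2 v1"

lemma four_cycle_structure_rotate:
  "four_cycle_structure C v1 v2 v3 v4 \<Longrightarrow> four_cycle_structure C v2 v3 v4 v1"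
  unfolding four_cycle_structure_def by auto

lemma card_colors_four:
  assumes nr: "\<not> has_rainbow_triangle V C" and n: "card V = 4"
  shows "card (colors V C) \<le> 6"
proof -
  have fin: "finite V" using n card.infinite by fastforce
  obtain v where v: "v \<in> V" "card (sat V C v) \<le> card V div 2" using ex_small_sat[OF nr fin] n by auto
  have "card (colors (V - {v}) C) \<le> 4"
    using card_colors_three[of "V - {v}" C] no_rainbow_mono[OF nr, of "V - {v}"] n v fin by auto
  then show ?thesis using card_colors_delete[OF fin, of C v] v n by auto
qed

text \<open>Equality in the count leaves an extremal triple and two saturated colours at
  \<open>v\<close>. By \<open>three_vertices_separate\<close> these cannot both leave or both enter
  \<open>v\<close>, so they join \<open>v\<close> to a single vertex \<open>x\<close>, which becomes
  opposite to \<open>v\<close> on the cycle.\<close>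

lemma four_vertices:
  assumes nr: "\<not> has_rainbow_triangle V C" and n: "card V = 4" and six: "6 \<le> card (colors V C)"
  shows "\<exists>v1 v2 v3 v4. V = {v1, v2, v3, v4} \<and> distinct [v1, v2, v3, v4] \<and>
    four_cycle_structure C v1 v2 v3 v4"
proof -
  have fin: "finite V" using n card.infinite by fastforce
  have nr': "\<not> has_rainbow_triangle V (rev_col C)" using nr by simp
  obtain v where v: "v \<in> V" "card (sat V C v) \<le> card V div 2" using ex_small_sat[OF nr fin] n by auto
  have nrv: "\<not> has_rainbow_triangle (V - {v}) C" using no_rainbow_mono[OF nr] by blast
  have cv: "card (V - {v}) = 3" using n v fin by simp
  have "card (colors (V - {v}) C) \<le> 4" using card_colors_three[OF nrv cv] .
  then have sat2: "2 \<le> card (sat V C v)" and col4: "4 \<le> card (colors (V - {v}) C)"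
    using card_colors_delete[OF fin, of C v] v n six by auto
  note sep = three_vertices_separate[OF nrv cv col4]
  have third: "\<exists>w \<in> V - {v}. w \<noteq> x \<and> w \<noteq> y" for x y
  proof (rule ccontr)
    assume "\<not> (\<exists>w \<in> V - {v}. w \<noteq> x \<and> w \<noteq> y)"
    then have "V - {v} \<subseteq> {x, y}" by auto
    then have "card (V - {v}) \<le> card {x, y}" by (intro card_mono) auto
    then show False using cv by (auto simp: card_insert_if split: if_splits)
  qed
  have "\<not> 2 \<le> card (out_sat V C v)"
  proof
    assume "2 \<le> card (out_sat V C v)"
    then obtain x y where xy: "x \<in> V - {v}" "y \<in> V - {v}" "x \<noteq> y"
      "\<And>w. w \<in> V - {v} \<Longrightarrow> w \<noteq> x \<Longrightarrow> w \<noteq> y \<Longrightarrow> C x w = C y w"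
      using two_out_common[OF nr v(1)] by metis
    then show False using third[of x y] sep(1)[of x y] by metis
  qed
  moreover have "\<not> 2 \<le> card (out_sat V (rev_col C) v)"
  proof
    assume "2 \<le> card (out_sat V (rev_col C) v)"
    then obtain x y where xy: "x \<in> V - {v}" "y \<in> V - {v}" "x \<noteq> y"
      "\<And>w. w \<in> V - {v} \<Longrightarrow> w \<noteq> x \<Longrightarrow> w \<noteq> y \<Longrightarrow> rev_col C x w = rev_col C y w"
      using two_out_common[OF nr' v(1)] by metis
    then show False using third[of x y] sep(2)[of x y] unfolding rev_col_apply by metis
  qed
  ultimately obtain x where x: "x \<in> V" "x \<noteq> v" "C v x \<in> sat V C v" "C x v \<in> sat V C v" "C v x \<noteq> C x v"
    and xw: "\<And>w. w \<in> V \<Longrightarrow> w \<noteq> v \<Longrightarrow> w \<noteq> x \<Longrightarrow> C w v = C x w \<and> C v w = C w x"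
    using sat_two_cases[OF nr v(1) fin sat2] by blast
  have "card (V - {v} - {x}) = 2" using cv x fin by simp
  then obtain y z where yz: "V - {v} - {x} = {y, z}" "y \<noteq> z" by (meson card_2_iff)
  then have mem: "y \<in> V" "z \<in> V" "y \<noteq> v" "y \<noteq> x" "z \<noteq> v" "z \<noteq> x" by auto
  have Vv: "V - {v} = {x, y, z}" using yz x by auto
  have three: "card {C x y, C y z, C z x} = 2 \<and> card {C x z, C z y, C y x} = 2 \<and>
      {C x y, C y z, C z x} \<inter> {C x z, C z y, C y x} = {}"
    using three_vertices(2)[of x y z C] nrv col4 mem yz(2) unfolding Vv by auto
  then have disj: "C x y \<notin> {C x z, C z y, C y x}" "C y z \<notin> {C x z, C z y, C y x}"
    "C z x \<notin> {C x z, C z y, C y x}" by auto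
  have e: "C y v = C x y" "C v y = C y x" "C z v = C x z" "C v z = C z x" using xw mem by auto
  \<comment> \<open>The arcs at \<open>v\<close> copy those at \<open>x\<close>, so each of the
    triangles \<open>v y z\<close> and \<open>v z y\<close> has two colours from one orientation of
    \<open>x y z\<close> and one from the other; only the former two can agree.\<close>
  have a: "C y x = C x z" using no_rainbowD[OF nr, of v y z] e disj mem v yz(2) by auto
  have b: "C z x = C x y" using no_rainbowD[OF nr, of v z y] e disj mem v yz(2) by auto
  have c: "C y z \<noteq> C x y" "C z y \<noteq> C x z" using three a b by auto
  have sn: "C i j \<noteq> C v x" "C i j \<noteq> C x v" if "i \<in> {x, y, z}" "j \<in> {x, y, z}" "i \<noteq> j" for i j
    using sat_neq[OF x(3), of i j] sat_neq[OF x(4), of i j] that Vv by auto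
  have "distinct [C y x, C x y, C y z, C z y, C x v, C v x]"
    using disj a b c sn mem yz(2) x(5) by auto
  then have "four_cycle_structure C y x z v"
    unfolding four_cycle_structure_def using e a b by simp
  moreover have "V = {y, x, z, v}" using Vv v by auto
  ultimately show ?thesis using mem x yz(2) by (metis distinct_length_2_or_more distinct_singleton)
qed

lemma four_vertices_at:
  assumes "\<not> has_rainbow_triangle V C" "card V = 4" "6 \<le> card (colors V C)" "x \<in> V"
  obtains y z w where "V = {x, y, z, w}" "distinct [x, y, z, w]" "four_cycle_structure C x y z w"
proof -
  obtain v1 v2 v3 v4 where V: "V = {v1, v2, v3, v4}" "distinct [v1, v2, v3, v4]"
    "four_cycle_structure C v1 v2 v3 v4" using four_vertices[OF assms(1-3)] by blast
  note r1 = four_cycle_structure_rotate[OF V(3)]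
  note r2 = four_cycle_structure_rotate[OF r1]
  note r3 = four_cycle_structure_rotate[OF r2]
  from assms(4) V(1) consider "x = v1" | "x = v2" | "x = v3" | "x = v4" by auto
  then show ?thesis
  proof cases
    case 1 then show ?thesis using that[of v2 v3 v4] V by auto
  next
    case 2 then show ?thesis using that[of v3 v4 v1] V r1 by auto
  next
    case 3 then show ?thesis using that[of v4 v1 v2] V r2 by auto
  next
    case 4 then show ?thesis using that[of v1 v2 v3] V r3 by auto
  qed
qed

text \<open>This excludes two saturated colours leaving, or entering, a fifth vertex attached to an
  extremal colouring of four vertices.\<close>

lemma four_vertices_separate:
  assumes "\<not> has_rainbow_triangle V C" "card V = 4" "6 \<le> card (colors V C)"
    and "x \<in> V" "y \<in> V" "x \<noteq> y"
  shows "\<exists>w\<in>V. w \<noteq> x \<and> w \<noteq> y \<and> C x w \<noteq> C y w" "\<exists>w\<in>V. w \<noteq> x \<and> w \<noteq> y \<and> C w x \<noteq> C w y"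
proof -
  obtain p q r where V: "V = {x, p, q, r}" "distinct [x, p, q, r]" "four_cycle_structure C x p q r"
    using four_vertices_at[OF assms(1-4)] .
  from assms(5,6) V(1) consider "y = p" | "y = q" | "y = r" by auto
  note c = this
  show "\<exists>w\<in>V. w \<noteq> x \<and> w \<noteq> y \<and> C x w \<noteq> C y w"
    using c V(2,3) unfolding V(1) four_cycle_structure_def by cases auto
  show "\<exists>w\<in>V. w \<noteq> x \<and> w \<noteq> y \<and> C w x \<noteq> C w y"
    using c V(2,3) unfolding V(1) four_cycle_structure_def by cases auto
qed

section \<open>Five vertices\<close>

text \<open>A cardinality in a form that an SMT solver can use: linear arithmetic over equalities.\<close>

fun count_new :: "nat list \<Rightarrow> int" where
  "count_new [] = 0"
| "count_new (x # xs) = count_new xs + (if x \<in> set xs then 0 else 1)"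

lemma card_set_count_new: "int (card (set xs)) = count_new xs"
  by (induction xs) (auto simp: card_insert_if)

text \<open>Vertices \<open>v, x1, x2, w1, w2\<close> with \<open>v x1\<close> and \<open>v x2\<close> local. Here \<open>ki\<close> is the colour of \<open>xi v\<close>,
  \<open>mj\<close> of \<open>wj v\<close>,
  \<open>hji\<close> of \<open>wj xi\<close>, \<open>gj\<close> of \<open>v wj\<close>, and \<open>e, f\<close> those of \<open>w1 w2,
    w2 w1\<close>; locality fixes the other colours.\<close>

lemma source_comb:
  fixes k1 k2 m1 m2 h11 h12 h21 h22 e f g1 g2 :: nat
  assumes "k2 = m1 \<or> m1 = h11 \<or> k2 = h11" "k1 = m1 \<or> m1 = h12 \<or> k1 = h12" "k2 = m2 \<or> m2 = h21 \<or> k2 = h21"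
    "k1 = m2 \<or> m2 = h22 \<or> k1 = h22" "m1 = e \<or> e = h21 \<or> m1 = h21" "m1 = e \<or> e = h22 \<or> m1 = h22"
    "m2 = f \<or> f = h11 \<or> m2 = h11" "m2 = f \<or> f = h12 \<or> m2 = h12" "g1 = e \<or> e = m2 \<or> g1 = m2"
    "g2 = f \<or> f = m1 \<or> g2 = m1" "g1 = h11 \<or> h11 = k1 \<or> g1 = k1" "g1 = h12 \<or> h12 = k2 \<or> g1 = k2"
    "g2 = h21 \<or> h21 = k1 \<or> g2 = k1" "g2 = h22 \<or> h22 = k2 \<or> g2 = k2"
    and "5 \<le> card {g2, g1, f, e, h22, h21, h12, h11, m2, m1, k2, k1}"
  shows "(k2 = k1 \<and> m1 = k1 \<and> m2 = k1 \<and> h11 = k1 \<and> h12 = k1 \<and> e = k1 \<and> g2 = k1) \<or>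
    (k2 = k1 \<and> m1 = k1 \<and> m2 = k1 \<and> h21 = k1 \<and> h22 = k1 \<and> f = k1 \<and> g1 = k1) \<or>
    (k2 = k1 \<and> m1 = k1 \<and> m2 = k1 \<and> e = k1 \<and> f = k1 \<and> g1 = k1 \<and> g2 = k1) \<or>
    (m2 = m1 \<and> h11 = m1 \<and> h12 = m1 \<and> h21 = m1 \<and> h22 = m1 \<and> g1 = m1 \<and> g2 = m1)"
proof -
  have "5 \<le> count_new [g2, g1, f, e, h22, h21, h12, h11, m2, m1, k2, k1]"
    unfolding card_set_count_new[symmetric] using assms(15) by simp
  then show ?thesis using assms(1-14)
    unfolding count_new.simps list.set insert_iff empty_iff by (smt (verit))
qed

text \<open>Vertices \<open>u, v, b1, b2, b3\<close> with \<open>u v\<close> and \<open>v u\<close> local. Here \<open>pi\<close> is the colour of \<open>v bi\<close> and \<open>bi u\<close>,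
  \<open>qi\<close> that of \<open>u bi\<close> and \<open>bi v\<close>, and \<open>aij\<close> that of \<open>bi bj\<close>.\<close>

lemma two_cycle_comb:
  fixes p1 p2 p3 q1 q2 q3 a12 a21 a13 a31 a23 a32 :: nat
  assumes "q1 = a12 \<or> a12 = p2 \<or> q1 = p2" "p1 = a12 \<or> a12 = q2 \<or> p1 = q2" "q1 = a13 \<or> a13 = p3 \<or> q1 = p3"
    "p1 = a13 \<or> a13 = q3 \<or> p1 = q3" "q2 = a21 \<or> a21 = p1 \<or> q2 = p1" "p2 = a21 \<or> a21 = q1 \<or> p2 = q1"
    "q2 = a23 \<or> a23 = p3 \<or> q2 = p3" "p2 = a23 \<or> a23 = q3 \<or> p2 = q3" "q3 = a31 \<or> a31 = p1 \<or> q3 = p1"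
    "p3 = a31 \<or> a31 = q1 \<or> p3 = q1" "q3 = a32 \<or> a32 = p2 \<or> q3 = p2" "p3 = a32 \<or> a32 = q2 \<or> p3 = q2"
    "a12 = a23 \<or> a23 = a31 \<or> a12 = a31" "a13 = a32 \<or> a32 = a21 \<or> a13 = a21"
    and "5 \<le> card {a32, a23, a31, a13, a21, a12, q3, q2, q1, p3, p2, p1}"
  shows "(p2 = p1 \<and> p3 = p1 \<and> q1 = p1 \<and> q2 = p1 \<and> q3 = p1) \<or>
    (p3 = p2 \<and> q2 = p2 \<and> q3 = p2 \<and> a12 = p2 \<and> a21 = p2 \<and> a13 = p2 \<and> a31 = p2) \<or>
    (p1 = p3 \<and> q3 = p3 \<and> q1 = p3 \<and> a23 = p3 \<and> a32 = p3 \<and> a21 = p3 \<and> a12 = p3) \<or>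
    (p2 = p1 \<and> q1 = p1 \<and> q2 = p1 \<and> a31 = p1 \<and> a13 = p1 \<and> a32 = p1 \<and> a23 = p1) \<or>
    (q1 = p1 \<and> a12 = p1 \<and> a21 = p1 \<and> a13 = p1 \<and> a31 = p1) \<or>
    (q2 = p2 \<and> a23 = p2 \<and> a32 = p2 \<and> a21 = p2 \<and> a12 = p2) \<or>
    (q3 = p3 \<and> a31 = p3 \<and> a13 = p3 \<and> a32 = p3 \<and> a23 = p3)"
proof -
  have "5 \<le> count_new [a32, a23, a31, a13, a21, a12, q3, q2, q1, p3, p2, p1]"
    unfolding card_set_count_new[symmetric] using assms(15) by simp
  then show ?thesis using assms(1-14)
    unfolding count_new.simps list.set insert_iff empty_iff by (smt (verit))
qed

text \<open>A vertex \<open>v\<close> added to the extremal colouring of \<open>v1, v2, v3, v4\<close>: \<open>oi\<close> is the colour of \<open>v vi\<close> and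
  \<open>ii\<close> that of \<open>vi v\<close>.\<close>

lemma type1_comb:
  fixes a b c d e f s :: nat
  assumes "distinct [a, b, c, d, e, f, s]" "o1 = s"
    "o1 = a \<or> a = i2 \<or> o1 = i2" "o1 = c \<or> c = i3 \<or> o1 = i3" "o1 = b \<or> b = i4 \<or> o1 = i4"
    "o2 = b \<or> b = i1 \<or> o2 = i1" "o2 = a \<or> a = i3 \<or> o2 = i3" "o2 = e \<or> e = i4 \<or> o2 = i4"
    "o3 = d \<or> d = i1 \<or> o3 = i1" "o3 = b \<or> b = i2 \<or> o3 = i2" "o3 = a \<or> a = i4 \<or> o3 = i4"
    "o4 = a \<or> a = i1 \<or> o4 = i1" "o4 = f \<or> f = i2 \<or> o4 = i2" "o4 = b \<or> b = i3 \<or> o4 = i3"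
  shows "i1 = s \<and> i2 = s \<and> i3 = s \<and> i4 = s \<and> o2 = s \<and> o3 = s \<and> o4 = s"
  using assms unfolding distinct.simps list.set insert_iff empty_iff by (smt (verit))

text \<open>With \<open>x\<close> rotated to the front of the four-cycle, the colour of
  \<open>v x\<close> is a seventh colour, and the twelve triangles through \<open>v\<close> spread
  it over all arcs at \<open>v\<close> by \<open>type1_comb\<close>.\<close>

lemma five_vertices_type1_aux:
  assumes nr: "\<not> has_rainbow_triangle V C" and n: "card V = 5" and v: "v \<in> V"
    and six: "6 \<le> card (colors (V - {v}) C)"
    and x: "x \<in> V" "x \<noteq> v" "C v x \<in> sat V C v" and u: "u \<in> V" "u \<noteq> v"
  shows "C v u = C v x \<and> C u v = C v x"
proof -
  have fin: "finite V" using n card.infinite by fastforce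
  have nrv: "\<not> has_rainbow_triangle (V - {v}) C" using no_rainbow_mono[OF nr] by blast
  have cv: "card (V - {v}) = 4" using n v fin by simp
  obtain y z w where V: "V - {v} = {x, y, z, w}" and d: "distinct [x, y, z, w]"
    and s: "four_cycle_structure C x y z w"
    using four_vertices_at[OF nrv cv six, of x] x by auto
  have mem: "x \<in> V" "y \<in> V" "z \<in> V" "w \<in> V" "x \<noteq> v" "y \<noteq> v" "z \<noteq> v" "w \<noteq> v" using V by auto
  have t: "C v i = C i j \<or> C i j = C j v \<or> C v i = C j v"
    if "i \<in> {x, y, z, w}" "j \<in> {x, y, z, w}" "i \<noteq> j" for i j
    using no_rainbowD[OF nr, of v i j] that mem v by auto
  have ne: "C i j \<noteq> C v x" if "i \<in> {x, y, z, w}" "j \<in> {x, y, z, w}" "i \<noteq> j" for i j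
    using sat_neq[OF x(3), of i j] that mem by auto
  have e: "C y z = C x y" "C z w = C x y" "C w x = C x y"
     "C x w = C y x" "C w z = C y x" "C z y = C y x" using s by (auto simp: four_cycle_structure_def)
  have dd: "distinct [C x y, C y x, C x z, C z x, C y w, C w y, C v x]"
    using s ne d by (auto simp: four_cycle_structure_def)
  have dn: "x \<noteq> y" "x \<noteq> z" "x \<noteq> w" "y \<noteq> z" "y \<noteq> w" "z \<noteq> w"
    "y \<noteq> x" "z \<noteq> x" "w \<noteq> x" "z \<noteq> y" "w \<noteq> y" "w \<noteq> z" using d by auto
  have "C x v = C v x \<and> C y v = C v x \<and> C z v = C v x \<and> C w v = C v x \<and>
    C v y = C v x \<and> C v z = C v x \<and> C v w = C v x"
    by (rule type1_comb[OF dd refl])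
      (use t[of x y] t[of x z] t[of x w] t[of y x] t[of y z] t[of y w] t[of z x] t[of z y] t[of z w]
       t[of w x] t[of w y] t[of w z] dn in \<open>simp_all add: e\<close>)
  moreover have "u \<in> {x, y, z, w}" using u V by auto
  ultimately show ?thesis by auto
qed

text \<open>Of the cases of \<open>sat_two_cases\<close>, the first two contradict
  \<open>four_vertices_separate\<close>. In the third the arcs at \<open>v\<close> copy those at
  \<open>x\<close>, and for \<open>y\<close> following \<open>x\<close> on the cycle and
  \<open>z\<close> opposite to \<open>x\<close> the triangle \<open>v y z\<close> has the colours of
  both cycles and a diagonal.\<close>

lemma five_vertices_sat_le_1:
  assumes nr: "\<not> has_rainbow_triangle V C" and n: "card V = 5" and v: "v \<in> V"
    and six: "6 \<le> card (colors (V - {v}) C)"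
  shows "card (sat V C v) \<le> 1"
proof (rule ccontr)
  assume "\<not> card (sat V C v) \<le> 1"
  then have two: "2 \<le> card (sat V C v)" by simp
  have fin: "finite V" using n card.infinite by fastforce
  have nr': "\<not> has_rainbow_triangle V (rev_col C)" using nr by simp
  have nrv: "\<not> has_rainbow_triangle (V - {v}) C" using no_rainbow_mono[OF nr] by blast
  have cv: "card (V - {v}) = 4" using n v fin by simp
  note sep = four_vertices_separate[OF nrv cv six]
  from sat_two_cases[OF nr v fin two] show False
  proof (elim disjE bexE conjE)
    assume "2 \<le> card (out_sat V C v)"
    then obtain x y where "x \<in> V - {v}" "y \<in> V - {v}" "x \<noteq> y"
      "\<And>w. w \<in> V - {v} \<Longrightarrow> w \<noteq> x \<Longrightarrow> w \<noteq> y \<Longrightarrow> C x w = C y w"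
      using two_out_common[OF nr v] by metis
    then show False using sep(1)[of x y] by blast
  next
    assume "2 \<le> card (out_sat V (rev_col C) v)"
    then obtain x y where "x \<in> V - {v}" "y \<in> V - {v}" "x \<noteq> y"
      "\<And>w. w \<in> V - {v} \<Longrightarrow> w \<noteq> x \<Longrightarrow> w \<noteq> y \<Longrightarrow> rev_col C x w = rev_col C y w"
      using two_out_common[OF nr' v] by metis
    then show False using sep(2)[of x y] by auto
  next
    fix x assume x: "x \<in> V" "x \<noteq> v" and xw: "\<forall>w\<in>V. w \<noteq> v \<longrightarrow> w \<noteq> x \<longrightarrow> C w v = C x w \<and> C v w = C w x"
    obtain y z w where V: "V - {v} = {x, y, z, w}" and d: "distinct [x, y, z, w]"
      and s: "four_cycle_structure C x y z w"
      using four_vertices_at[OF nrv cv six, of x] x by auto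
    have mem: "y \<in> V" "z \<in> V" "y \<noteq> v" "z \<noteq> v" using V by auto
    then show False
      using no_rainbowD[OF nr v, of y z] s xw[rule_format, of y] xw[rule_format, of z] d
      by (auto simp: four_cycle_structure_def)
  qed
qed

text \<open>Four vertices carry at most six colours, so a seventh is saturated at \<open>v\<close>;
  it spreads by \<open>five_vertices_type1_aux\<close>, after reversal if it lies on an
  in-arc.\<close>

lemma five_vertices_type1:
  assumes nr: "\<not> has_rainbow_triangle V C" and n: "card V = 5" and v: "v \<in> V"
    and six: "6 \<le> card (colors (V - {v}) C)" and seven: "7 \<le> card (colors V C)"
  shows "\<exists>c. (\<forall>u \<in> V - {v}. C v u = c \<and> C u v = c) \<and> c \<notin> colors (V - {v}) C"
proof -
  have fin: "finite V" using n card.infinite by fastforce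
  have "card (colors (V - {v}) C) \<le> 6"
    using card_colors_four[of "V - {v}" C] no_rainbow_mono[OF nr, of "V - {v}"] n v fin by auto
  then have "1 \<le> card (sat V C v)" using card_colors_delete[OF fin, of C v] seven by linarith
  then obtain s where s: "s \<in> sat V C v" by fastforce
  obtain x where x: "x \<in> V" "x \<noteq> v" "s = C v x \<or> s = C x v" using sat_arc[OF s] by metis
  have "\<forall>u \<in> V - {v}. C v u = s \<and> C u v = s"
  proof (cases "s = C v x")
    case True
    then show ?thesis using five_vertices_type1_aux[OF nr n v six x(1,2)] s by auto
  next
    case False
    then have sx: "C x v = s" using x by simp
    have nr': "\<not> has_rainbow_triangle V (rev_col C)" using nr by simp
    have six': "6 \<le> card (colors (V - {v}) (rev_col C))" using six by simp
    have sx': "rev_col C v x \<in> sat V (rev_col C) v" using sx s by simp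
    show ?thesis
      using five_vertices_type1_aux[OF nr' n v six' x(1,2) sx'] sx unfolding rev_col_apply by blast
  qed
  then show ?thesis using s by (auto simp: sat_def)
qed

text \<open>At a vertex saturating at most two colours, either the rest has at most five colours, or
  it has six and only one is saturated.\<close>

lemma card_colors_five:
  assumes nr: "\<not> has_rainbow_triangle V C" and n: "card V = 5"
  shows "card (colors V C) \<le> 7"
proof -
  have fin: "finite V" using n card.infinite by fastforce
  obtain v where v: "v \<in> V" "card (sat V C v) \<le> card V div 2" using ex_small_sat[OF nr fin] n by auto
  have "card (colors (V - {v}) C) \<le> 6"
    using card_colors_four[of "V - {v}" C] no_rainbow_mono[OF nr, of "V - {v}"] n v fin by auto
  then show ?thesis
    using card_colors_delete[OF fin, of C v] v n five_vertices_sat_le_1[OF nr n v(1)] by fastforce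
qed

section \<open>Types II and III, recognised by counting colours\<close>

definition type2_structure :: "'a set \<Rightarrow> ('a \<Rightarrow> 'a \<Rightarrow> nat) \<Rightarrow> bool" where
  "type2_structure V C \<longleftrightarrow> (\<exists>A B. A \<union> B = V \<and> A \<inter> B = {} \<and> card A = 2 \<and> card B = 3 \<and>
     bip_structure V A B C)"

text \<open>Cardinalities and disjointness replace the naming of seven colours, which suits counting
  and reversal; \<open>type3_structure_letters\<close> restores the names.\<close>

definition type3_structure :: "'a set \<Rightarrow> ('a \<Rightarrow> 'a \<Rightarrow> nat) \<Rightarrow> bool" where
  "type3_structure V C \<longleftrightarrow> (\<exists>A B. A \<union> B = V \<and> A \<inter> B = {} \<and> card A = 2 \<and> card B = 3 \<and>
     card (colors A C) = 2 \<and> card (colors B C) = 4 \<and> colors A C \<inter> colors B C = {} \<and>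
     (\<exists>g. g \<notin> colors A C \<union> colors B C \<and> (\<forall>x\<in>A. \<forall>y\<in>B. C x y = g \<and> C y x = g)))"

lemma bip_structure_rev:
  assumes "bip_structure V A B (rev_col C)"
  shows "bip_structure V A B C"
proof -
  obtain H c where H: "H = A \<times> B \<or> H = B \<times> A" "rainbow H (rev_col C)"
    "\<forall>(x, y) \<in> arcs V - H. C y x = c" "c \<notin> (\<lambda>(x, y). C y x) ` H"
    using assms unfolding bip_structure_def rev_col_apply by blast
  have "H\<inverse> = A \<times> B \<or> H\<inverse> = B \<times> A" using H(1) by auto
  moreover have "rainbow (H\<inverse>) C" using H(2) unfolding rainbow_def inj_on_def by force
  moreover have "\<forall>(x, y) \<in> arcs V - H\<inverse>. C x y = c" using H(3) by (auto simp: arcs_def)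
  moreover have "c \<notin> (\<lambda>(x, y). C x y) ` (H\<inverse>)" using H(4) by (auto simp: image_iff)
  ultimately show ?thesis unfolding bip_structure_def by blast
qed

lemma type2_structure_rev: "type2_structure V (rev_col C) \<Longrightarrow> type2_structure V C"
  unfolding type2_structure_def using bip_structure_rev[of V _ _ C] by blast

lemma type3_structure_rev: "type3_structure V (rev_col C) \<Longrightarrow> type3_structure V C"
  unfolding type3_structure_def colors_rev rev_col_apply by blast

text \<open>The arcs from \<open>A\<close> to \<open>B\<close> supply at most
  \<open>card A * card B\<close> colours and all others only \<open>g\<close>, so the assumed number
  forces these arcs to be rainbow and \<open>g\<close> to be new. The two conclusions allow either
  part to be listed first.\<close>

lemma bip_structureI:
  assumes fin: "finite A" "finite B" and V: "A \<union> B = V" "A \<inter> B = {}"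
    and g: "\<And>x y. x \<in> V \<Longrightarrow> y \<in> V \<Longrightarrow> x \<noteq> y \<Longrightarrow> \<not> (x \<in> A \<and> y \<in> B) \<Longrightarrow> C x y = g"
    and n: "card A * card B + 1 \<le> card (colors V C)"
  shows "bip_structure V A B C" "bip_structure V B A C"
proof -
  let ?f = "\<lambda>(x, y). C x y"
  have sub: "colors V C \<subseteq> insert g (?f ` (A \<times> B))"
    unfolding subset_iff colors_iff using g by (auto simp: image_iff)
  have "card (colors V C) \<le> card (insert g (?f ` (A \<times> B)))"
    using sub fin by (intro card_mono) auto
  also have "\<dots> \<le> card (?f ` (A \<times> B)) + 1" by (simp add: card_insert_if fin)
  finally have "card (A \<times> B) \<le> card (?f ` (A \<times> B))" using n by (simp add: card_cartesian_product)
  then have "card (?f ` (A \<times> B)) = card (A \<times> B)" using card_image_le[of "A \<times> B" ?f] fin by auto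
  then have inj: "inj_on ?f (A \<times> B)" using eq_card_imp_inj_on[OF finite_cartesian_product[OF fin]] by metis
  have gn: "g \<notin> ?f ` (A \<times> B)"
  proof
    assume "g \<in> ?f ` (A \<times> B)"
    then have "colors V C \<subseteq> ?f ` (A \<times> B)" using sub by auto
    then have "card (colors V C) \<le> card (?f ` (A \<times> B))" using fin by (intro card_mono) auto
    then show False using n card_image[OF inj] by (simp add: card_cartesian_product)
  qed
  have eq: "\<forall>(x, y) \<in> arcs V - A \<times> B. C x y = g" using g by (auto simp: arcs_def)
  show "bip_structure V A B C" "bip_structure V B A C"
    unfolding bip_structure_def rainbow_def using inj gn eq by blast+
qed

lemma card_colors_pair: "card A = 2 \<Longrightarrow> card (colors A C) \<le> 2"
proof -
  assume "card A = 2"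
  then obtain x y where A: "A = {x, y}" by (meson card_2_iff)
  have "colors A C \<subseteq> {C x y, C y x}" unfolding A by (auto simp: colors_iff)
  then have "card (colors A C) \<le> card {C x y, C y x}" by (intro card_mono) auto
  also have "\<dots> \<le> 2" by (simp add: card_insert_if)
  finally show ?thesis .
qed

text \<open>At most two colours come from \<open>A\<close>, four from \<open>B\<close> and one from
  the arcs between them, so seven colours make every estimate tight.\<close>

lemma type3_structureI:
  assumes nr: "\<not> has_rainbow_triangle V C" and V: "A \<union> B = V" "A \<inter> B = {}" "card A = 2" "card B = 3"
    and g: "\<And>x y. x \<in> A \<Longrightarrow> y \<in> B \<Longrightarrow> C x y = g \<and> C y x = g"
    and n: "7 \<le> card (colors V C)"
  shows "type3_structure V C"
proof -
  have fin: "finite A" "finite B" using V card.infinite by fastforce+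
  note fc = finite_colors[OF fin(1), of C] finite_colors[OF fin(2), of C]
  let ?U = "colors A C \<union> colors B C"
  have B4: "card (colors B C) \<le> 4"
    using card_colors_three[of B C] no_rainbow_mono[OF nr, of B] V by auto
  have A2: "card (colors A C) \<le> 2" using card_colors_pair[OF V(3)] .
  have sub: "colors V C \<subseteq> insert g ?U"
    using g unfolding subset_iff colors_iff V(1)[symmetric] by (auto simp: colors_iff)
  then have le: "card (colors V C) \<le> card (insert g ?U)" using fc by (intro card_mono) auto
  have Un: "card ?U + card (colors A C \<inter> colors B C) = card (colors A C) + card (colors B C)"
    using card_Un_Int[OF fc] by simp
  have gU: "g \<notin> ?U"
  proof
    assume "g \<in> ?U"
    then have "card (insert g ?U) = card ?U" by (simp add: insert_absorb)
    then show False using n le Un A2 B4 by linarith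
  qed
  then have ins: "card (insert g ?U) = 1 + card ?U" using fc by simp
  have "card (colors A C) = 2" "card (colors B C) = 4" "card (colors A C \<inter> colors B C) = 0"
    using n le Un A2 B4 ins by linarith+
  moreover from this(3) have "colors A C \<inter> colors B C = {}" using fc by simp
  moreover have "\<exists>g. g \<notin> ?U \<and> (\<forall>x\<in>A. \<forall>y\<in>B. C x y = g \<and> C y x = g)" using gU g by (intro exI[of _ g]) simp
  ultimately show ?thesis unfolding type3_structure_def using V by (intro exI[of _ A] exI[of _ B] conjI)
qed

text \<open>The colour is thus saturated at both ends; it may still recur on the opposite arc
  \<open>v u\<close>.\<close>

definition local_arc :: "'a set \<Rightarrow> ('a \<Rightarrow> 'a \<Rightarrow> nat) \<Rightarrow> 'a \<Rightarrow> 'a \<Rightarrow> bool" where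
  "local_arc V C u v \<longleftrightarrow> u \<in> V \<and> v \<in> V \<and> u \<noteq> v \<and>
     (\<forall>x\<in>V. \<forall>y\<in>V. x \<noteq> y \<longrightarrow> C x y = C u v \<longrightarrow> {x, y} = {u, v})"

lemma local_arc_rev: "local_arc V C u v \<Longrightarrow> local_arc V (rev_col C) v u"
proof -
  assume l: "local_arc V C u v"
  have "{x, y} = {v, u}" if "x \<in> V" "y \<in> V" "x \<noteq> y" "C y x = C u v" for x y
  proof -
    have "{y, x} = {u, v}" using l that unfolding local_arc_def by metis
    then show ?thesis by (simp add: insert_commute)
  qed
  then show ?thesis using l unfolding local_arc_def rev_col_apply by (intro conjI ballI impI) blast+
qed

lemma local_arcD:
  assumes "local_arc V C u v" "x \<in> V" "y \<in> V" "x \<noteq> y" "x \<noteq> u \<and> x \<noteq> v \<or> y \<noteq> u \<and> y \<noteq> v"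
  shows "C x y \<noteq> C u v"
proof
  assume "C x y = C u v"
  then have "{x, y} = {u, v}" using assms unfolding local_arc_def by blast
  then show False using assms(5) by blast
qed

text \<open>The arcs \<open>v w\<close> and \<open>w u\<close> leave the pair, so neither repeats
  the local colour, and the triangle \<open>u v w\<close> makes them agree.\<close>

lemma local_arc_through:
  assumes nr: "\<not> has_rainbow_triangle V C" and l: "local_arc V C u v"
    and w: "w \<in> V" "w \<noteq> u" "w \<noteq> v"
  shows "C v w = C w u"
proof -
  have uv: "u \<in> V" "v \<in> V" "u \<noteq> v" using l by (auto simp: local_arc_def)
  show ?thesis
    using no_rainbowD[OF nr uv(1,2) w(1) uv(3) w(3)[symmetric] w(2)[symmetric]]
      local_arcD[OF l uv(2) w(1)] local_arcD[OF l w(1) uv(1)] w by metis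
qed

text \<open>Discarding two local colours from seven leaves the five that \<open>source_comb\<close>
  and \<open>two_cycle_comb\<close> require.\<close>

lemma five_le_card_nonlocal:
  assumes "7 \<le> card M" "M \<subseteq> insert a (insert b S)" "finite S"
  shows "5 \<le> card (S :: nat set)"
proof -
  have "card M \<le> card (insert a (insert b S))" using assms by (intro card_mono) auto
  also have "\<dots> \<le> card S + 2" using assms(3) by (simp add: card_insert_if)
  finally show ?thesis using assms(1) by simp
qed

lemma type2_structureI:
  assumes "bip_structure V A B C" "A \<union> B = V" "A \<inter> B = {}" "card A = 2" "card B = 3"
  shows "type2_structure V C"
  using assms unfolding type2_structure_def by blast

text \<open>By \<open>local_arc_through\<close> six arcs copy others, which leaves twelve colours
  for \<open>source_comb\<close>. Its first three patterns are Type II with different bipartitions,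
  the last is Type III.\<close>

lemma five_vertices_source:
  assumes nr: "\<not> has_rainbow_triangle V C" and V: "V = {v, x1, x2, w1, w2}"
    and d: "distinct [v, x1, x2, w1, w2]" and seven: "7 \<le> card (colors V C)"
    and l: "local_arc V C v x1" "local_arc V C v x2"
  shows "type2_structure V C \<or> type3_structure V C"
proof -
  have dn: "v \<noteq> x1" "v \<noteq> x2" "v \<noteq> w1" "v \<noteq> w2" "x1 \<noteq> x2" "x1 \<noteq> w1" "x1 \<noteq> w2" "x2 \<noteq> w1" "x2 \<noteq> w2"
    "w1 \<noteq> w2" "x1 \<noteq> v" "x2 \<noteq> v" "w1 \<noteq> v" "w2 \<noteq> v" "x2 \<noteq> x1" "w1 \<noteq> x1" "w2 \<noteq> x1" "w1 \<noteq> x2" "w2 \<noteq> x2"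
    "w2 \<noteq> w1" using d by auto
  have mem: "v \<in> V" "x1 \<in> V" "x2 \<in> V" "w1 \<in> V" "w2 \<in> V" using V by auto
  note th = local_arc_through[OF nr l(1)] local_arc_through[OF nr l(2)]
  have e: "C x1 x2 = C x2 v" "C x2 x1 = C x1 v" "C x1 w1 = C w1 v" "C x2 w1 = C w1 v"
    "C x1 w2 = C w2 v" "C x2 w2 = C w2 v" using th mem dn by auto
  note T = no_rainbowD[OF nr]
  have c5: "5 \<le> card {C v w2, C v w1, C w2 w1, C w1 w2, C w2 x2, C w2 x1, C w1 x2, C w1 x1,
      C w2 v, C w1 v, C x2 v, C x1 v}"
    by (rule five_le_card_nonlocal[OF seven, of "C v x1" "C v x2"]) (auto simp: colors_iff V e)
  have "(C x2 v = C x1 v \<and> C w1 v = C x1 v \<and> C w2 v = C x1 v \<and> C w1 x1 = C x1 v \<and> C w1 x2 = C x1 v \<and>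
      C w1 w2 = C x1 v \<and> C v w2 = C x1 v) \<or>
    (C x2 v = C x1 v \<and> C w1 v = C x1 v \<and> C w2 v = C x1 v \<and> C w2 x1 = C x1 v \<and> C w2 x2 = C x1 v \<and>
      C w2 w1 = C x1 v \<and> C v w1 = C x1 v) \<or>
    (C x2 v = C x1 v \<and> C w1 v = C x1 v \<and> C w2 v = C x1 v \<and> C w1 w2 = C x1 v \<and> C w2 w1 = C x1 v \<and>
      C v w1 = C x1 v \<and> C v w2 = C x1 v) \<or>
    (C w2 v = C w1 v \<and> C w1 x1 = C w1 v \<and> C w1 x2 = C w1 v \<and> C w2 x1 = C w1 v \<and> C w2 x2 = C w1 v \<and>
      C v w1 = C w1 v \<and> C v w2 = C w1 v)"
    (is "?c1 \<or> ?c2 \<or> ?c3 \<or> ?c4")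
    by (rule source_comb[OF T[of x1 x2 w1, unfolded e] T[of x2 x1 w1, unfolded e]
        T[of x1 x2 w2, unfolded e] T[of x2 x1 w2, unfolded e] T[of x1 w1 w2, unfolded e]
        T[of x2 w1 w2, unfolded e] T[of x1 w2 w1, unfolded e] T[of x2 w2 w1, unfolded e]
        T[of v w1 w2] T[of v w2 w1] T[of v w1 x1] T[of v w1 x2] T[of v w2 x1] T[of v w2 x2] c5])
      (rule mem dn)+
  then show ?thesis
  proof (elim disjE)
    assume a: ?c1
    have "bip_structure V {v, w2} {x1, x2, w1} C"
      by (rule bip_structureI(1)[where g = "C x1 v"]) (use a e d V seven in auto)
    then have "type2_structure V C" by (rule type2_structureI) (use V d in auto)
    then show ?thesis ..
  next
    assume a: ?c2
    have "bip_structure V {v, w1} {x1, x2, w2} C"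
      by (rule bip_structureI(1)[where g = "C x1 v"]) (use a e d V seven in auto)
    then have "type2_structure V C" by (rule type2_structureI) (use V d in auto)
    then show ?thesis ..
  next
    assume a: ?c3
    \<comment> \<open>Here the rainbow arcs run from the triple to the pair, hence the second
      conclusion of \<open>bip_structureI\<close>.\<close>
    have "bip_structure V {x1, x2} {v, w1, w2} C"
      by (rule bip_structureI(2)[where g = "C x1 v"]) (use a e d V seven in auto)
    then have "type2_structure V C" by (rule type2_structureI) (use V d in auto)
    then show ?thesis ..
  next
    assume a: ?c4
    have "type3_structure V C"
      by (rule type3_structureI[OF nr, where g = "C w1 v" and A = "{w1, w2}" and B = "{v, x1, x2}"])
        (use a e d V seven in auto)
    then show ?thesis ..
  qed
qed

lemma sat_constant_vertex:
  assumes "\<forall>u \<in> V - {w}. C w u = c \<and> C u w = c"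
  shows "card (sat V C w) \<le> 1"
proof -
  have "sat V C w \<subseteq> {c}"
  proof
    fix s assume "s \<in> sat V C w"
    then obtain x where "x \<in> V" "x \<noteq> w" "s = C w x \<or> s = C x w" using sat_arc by metis
    then show "s \<in> {c}" using assms by auto
  qed
  then have "card (sat V C w) \<le> card {c}" by (intro card_mono) auto
  then show ?thesis by simp
qed

text \<open>Four patterns of \<open>two_cycle_comb\<close> are Type III, with different pairs as the
  part of size two. The other three make all arcs at some \<open>bi\<close> monochromatic, which
  \<open>del\<close> forbids.\<close>

lemma five_vertices_two_cycle:
  assumes nr: "\<not> has_rainbow_triangle V C" and V: "V = {u, v, b1, b2, b3}"
    and d: "distinct [u, v, b1, b2, b3]" and seven: "7 \<le> card (colors V C)"
    and l: "local_arc V C u v" "local_arc V C v u"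
    and del: "\<And>w. w \<in> V \<Longrightarrow> card (colors (V - {w}) C) \<le> 5"
  shows "type3_structure V C"
proof -
  have dn: "u \<noteq> v" "u \<noteq> b1" "u \<noteq> b2" "u \<noteq> b3" "v \<noteq> b1" "v \<noteq> b2" "v \<noteq> b3" "b1 \<noteq> b2" "b1 \<noteq> b3"
    "b2 \<noteq> b3" "v \<noteq> u" "b1 \<noteq> u" "b2 \<noteq> u" "b3 \<noteq> u" "b1 \<noteq> v" "b2 \<noteq> v" "b3 \<noteq> v" "b2 \<noteq> b1" "b3 \<noteq> b1"
    "b3 \<noteq> b2" using d by auto
  have mem: "u \<in> V" "v \<in> V" "b1 \<in> V" "b2 \<in> V" "b3 \<in> V" using V by auto
  note th = local_arc_through[OF nr l(1)] local_arc_through[OF nr l(2)]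
  have e: "C b1 u = C v b1" "C b2 u = C v b2" "C b3 u = C v b3"
    "C b1 v = C u b1" "C b2 v = C u b2" "C b3 v = C u b3" using th mem dn by auto
  have fin: "finite V" using V by simp
  \<comment> \<open>Such a vertex saturates at most one colour, so there would be at most
    \<open>5 + 1\<close> colours in total.\<close>
  have const: False if w: "w \<in> V" "\<forall>x \<in> V - {w}. C w x = c \<and> C x w = c" for w c
    using sat_constant_vertex[OF w(2)] del[OF w(1)] seven card_colors_delete[OF fin, of C w] by linarith
  note T = no_rainbowD[OF nr]
  have c5: "5 \<le> card {C b3 b2, C b2 b3, C b3 b1, C b1 b3, C b2 b1, C b1 b2,
      C u b3, C u b2, C u b1, C v b3, C v b2, C v b1}"
    by (rule five_le_card_nonlocal[OF seven, of "C u v" "C v u"]) (auto simp: colors_iff V e)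
  have "(C v b2 = C v b1 \<and> C v b3 = C v b1 \<and> C u b1 = C v b1 \<and> C u b2 = C v b1 \<and> C u b3 = C v b1) \<or>
    (C v b3 = C v b2 \<and> C u b2 = C v b2 \<and> C u b3 = C v b2 \<and> C b1 b2 = C v b2 \<and> C b2 b1 = C v b2 \<and>
      C b1 b3 = C v b2 \<and> C b3 b1 = C v b2) \<or>
    (C v b1 = C v b3 \<and> C u b3 = C v b3 \<and> C u b1 = C v b3 \<and> C b2 b3 = C v b3 \<and> C b3 b2 = C v b3 \<and>
      C b2 b1 = C v b3 \<and> C b1 b2 = C v b3) \<or>
    (C v b2 = C v b1 \<and> C u b1 = C v b1 \<and> C u b2 = C v b1 \<and> C b3 b1 = C v b1 \<and> C b1 b3 = C v b1 \<and>
      C b3 b2 = C v b1 \<and> C b2 b3 = C v b1) \<or>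
    (C u b1 = C v b1 \<and> C b1 b2 = C v b1 \<and> C b2 b1 = C v b1 \<and> C b1 b3 = C v b1 \<and> C b3 b1 = C v b1) \<or>
    (C u b2 = C v b2 \<and> C b2 b3 = C v b2 \<and> C b3 b2 = C v b2 \<and> C b2 b1 = C v b2 \<and> C b1 b2 = C v b2) \<or>
    (C u b3 = C v b3 \<and> C b3 b1 = C v b3 \<and> C b1 b3 = C v b3 \<and> C b3 b2 = C v b3 \<and> C b2 b3 = C v b3)"
    (is "?c1 \<or> ?c2 \<or> ?c3 \<or> ?c4 \<or> ?c5 \<or> ?c6 \<or> ?c7")
    by (rule two_cycle_comb[OF T[of u b1 b2, unfolded e] T[of v b1 b2, unfolded e]
      T[of u b1 b3, unfolded e] T[of v b1 b3, unfolded e]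
      T[of u b2 b1, unfolded e] T[of v b2 b1, unfolded e]
      T[of u b2 b3, unfolded e] T[of v b2 b3, unfolded e]
      T[of u b3 b1, unfolded e] T[of v b3 b1, unfolded e]
      T[of u b3 b2, unfolded e] T[of v b3 b2, unfolded e]
      T[of b1 b2 b3] T[of b1 b3 b2] c5])
      (rule mem dn)+
  then show ?thesis
  proof (elim disjE)
    assume a: ?c1
    show ?thesis
      by (rule type3_structureI[OF nr, where g = "C v b1" and A = "{u, v}" and B = "{b1, b2, b3}"])
        (use a e d V seven in auto)
  next
    assume a: ?c2
    show ?thesis
      by (rule type3_structureI[OF nr, where g = "C v b2" and A = "{b2, b3}" and B = "{u, v, b1}"])
        (use a e d V seven in auto)
  next
    assume a: ?c3
    show ?thesis
      by (rule type3_structureI[OF nr, where g = "C v b3" and A = "{b3, b1}" and B = "{u, v, b2}"])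
        (use a e d V seven in auto)
  next
    assume a: ?c4
    show ?thesis
      by (rule type3_structureI[OF nr, where g = "C v b1" and A = "{b1, b2}" and B = "{u, v, b3}"])
        (use a e d V seven in auto)
  next
    assume a: ?c5
    then show ?thesis using const[OF mem(3), of "C v b1"] e unfolding V by auto
  next
    assume a: ?c6
    then show ?thesis using const[OF mem(4), of "C v b2"] e unfolding V by auto
  next
    assume a: ?c7
    then show ?thesis using const[OF mem(5), of "C v b3"] e unfolding V by auto
  qed
qed

text \<open>Two meeting arcs share a tail, share a head, form a directed path or form a two-cycle.
  Shared heads reduce to shared tails by reversal.\<close>

lemma two_local_arcs:
  assumes nr: "\<not> has_rainbow_triangle V C" and n: "card V = 5" and seven: "7 \<le> card (colors V C)"
    and del: "\<And>w. w \<in> V \<Longrightarrow> card (colors (V - {w}) C) \<le> 5"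
    and l1: "local_arc V C u1 v1" and l2: "local_arc V C u2 v2"
    and ne: "C u1 v1 \<noteq> C u2 v2" and meet: "{u1, v1} \<inter> {u2, v2} \<noteq> {}"
  shows "type2_structure V C \<or> type3_structure V C"
proof -
  have fin: "finite V" using n card.infinite by fastforce
  have m: "u1 \<in> V" "v1 \<in> V" "u1 \<noteq> v1" "u2 \<in> V" "v2 \<in> V" "u2 \<noteq> v2"
    using l1 l2 by (auto simp: local_arc_def)
  \<comment> \<open>Stated for any colouring \<open>C'\<close>, so that it serves both
    \<open>C\<close> and its reversal.\<close>
  have source: "type2_structure V C' \<or> type3_structure V C'"
    if "\<not> has_rainbow_triangle V C'" "7 \<le> card (colors V C')" "local_arc V C' v x1" "local_arc V C' v x2"
      "x1 \<noteq> x2" for C' v x1 x2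
  proof -
    have d: "v \<in> V" "x1 \<in> V" "x2 \<in> V" "v \<noteq> x1" "v \<noteq> x2" using that by (auto simp: local_arc_def)
    then have "card (V - {v, x1, x2}) = 2" using n fin that(5) by (simp add: card_Diff_subset)
    then obtain w1 w2 where w: "V - {v, x1, x2} = {w1, w2}" "w1 \<noteq> w2" by (meson card_2_iff)
    have V: "V = {v, x1, x2, w1, w2}" using w(1) d by auto
    have "distinct [v, x1, x2, w1, w2]" using w d that(5) by auto
    then show ?thesis using five_vertices_source[OF that(1) V _ that(2-4)] by blast
  qed
  consider "u1 = u2" "v1 \<noteq> v2" | "v1 = v2" "u1 \<noteq> u2" | "v1 = u2" "v2 \<noteq> u1" | "u1 = v2" "u2 \<noteq> v1"
    | "u1 = v2" "v1 = u2" using meet ne by auto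
  then show ?thesis
  proof cases
    case 1
    then show ?thesis using source[OF nr seven l1, of v2] l2 by auto
  next
    case 2
    have "type2_structure V (rev_col C) \<or> type3_structure V (rev_col C)"
      using source[of "rev_col C" v1 u1 u2] nr seven local_arc_rev[OF l1] local_arc_rev[OF l2] 2 by auto
    then show ?thesis using type2_structure_rev[of V C] type3_structure_rev[of V C] by blast
  next
    case 3
    \<comment> \<open>A directed path of two local arcs is impossible: the closing arc
      \<open>v2 u1\<close> would repeat the local colour of the second arc.\<close>
    have "C v1 v2 = C v2 u1" using local_arc_through[OF nr l1 m(5)] 3 m by auto
    then show ?thesis using local_arcD[OF l2, of v2 u1] 3 m by auto
  next
    case 4
    have "C v2 v1 = C v1 u2" using local_arc_through[OF nr l2 m(2)] 4 m by auto
    then show ?thesis using local_arcD[OF l1, of v1 u2] 4 m by auto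
  next
    case 5
    have "card (V - {u1, v1}) = 3" using n fin m by (simp add: card_Diff_subset)
    then obtain b1 b2 b3 where b: "V - {u1, v1} = {b1, b2, b3}" "b1 \<noteq> b2" "b2 \<noteq> b3" "b1 \<noteq> b3"
      by (metis card_3_iff)
    have V: "V = {u1, v1, b1, b2, b3}" using b(1) m by auto
    have d: "distinct [u1, v1, b1, b2, b3]" using b m by auto
    have "local_arc V C v1 u1" using l2 5 by simp
    then show ?thesis using five_vertices_two_cycle[OF nr V d seven l1 _ del] by blast
  qed
qed

section \<open>Double counting of saturated colours on five vertices\<close>

lemma private_vertices_subset:
  assumes "x \<in> V" "y \<in> V" "x \<noteq> y"
  shows "{v \<in> V. C x y \<in> sat V C v} \<subseteq> {x, y}"
  using assms sat_neq[of "C x y" V C _ x y] by auto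

text \<open>Every arc of colour \<open>c\<close> contains all vertices at which \<open>c\<close> is
  saturated; two such vertices are therefore the ends of each of these arcs.\<close>

lemma local_arc_of_private:
  assumes c: "c \<in> colors V C" and two: "2 \<le> card {v \<in> V. c \<in> sat V C v}"
  obtains u v where "local_arc V C u v" "c = C u v"
proof -
  let ?P = "{v \<in> V. c \<in> sat V C v}"
  have eq: "?P = {x, y}" if "x \<in> V" "y \<in> V" "x \<noteq> y" "C x y = c" for x y
  proof -
    have "?P \<subseteq> {x, y}" using private_vertices_subset[OF that(1-3), of C] that(4) by simp
    moreover have "card {x, y} \<le> card ?P" using two that(3) by simp
    ultimately show ?thesis by (intro card_seteq) auto
  qed
  obtain x y where xy: "x \<in> V" "y \<in> V" "x \<noteq> y" "c = C x y" using c by (auto simp: colors_iff)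
  have "local_arc V C x y"
    unfolding local_arc_def
  proof (intro conjI ballI impI xy(1-3))
    fix a b assume "a \<in> V" "b \<in> V" "a \<noteq> b" "C a b = C x y"
    then have "?P = {a, b}" using eq xy(4) by simp
    moreover have "?P = {x, y}" using eq xy by simp
    ultimately show "{a, b} = {x, y}" by simp
  qed
  then show ?thesis using that xy(4) by blast
qed

text \<open>Each vertex saturates at least two colours, giving ten incidences. Each of the seven
  colours accounts for at most two, so \<open>10 <= 7 + card L\<close> and three colours are local.
  Their pairs cannot be disjoint within five vertices.\<close>

lemma five_vertices:
  assumes nr: "\<not> has_rainbow_triangle V C" and n: "card V = 5" and seven: "7 \<le> card (colors V C)"
    and del: "\<And>w. w \<in> V \<Longrightarrow> card (colors (V - {w}) C) \<le> 5"
  shows "type2_structure V C \<or> type3_structure V C"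
proof -
  have fin: "finite V" using n card.infinite by fastforce
  have fc: "finite (colors V C)" using finite_colors[OF fin] .
  have col: "card (colors V C) = 7" using card_colors_five[OF nr n] seven by simp
  define P where "P c = {v \<in> V. c \<in> sat V C v}" for c
  define L where "L = {c \<in> colors V C. 2 \<le> card (P c)}"
  have "2 \<le> card (sat V C v)" if "v \<in> V" for v
    using del[OF that] card_colors_delete[OF fin, of C v] seven by linarith
  then have "(\<Sum>v\<in>V. 2) \<le> (\<Sum>v\<in>V. card (sat V C v))" by (intro sum_mono) auto
  also have "\<dots> = (\<Sum>v\<in>V. card {c \<in> colors V C. c \<in> sat V C v})"
    by (intro sum.cong refl arg_cong[where f = card]) (auto simp: sat_def)
  also have "\<dots> = (\<Sum>c\<in>colors V C. card (P c))"
    by (rule sum_multicount_gen[OF fin fc]) (simp add: P_def)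
  also have "\<dots> \<le> (\<Sum>c\<in>colors V C. 1 + (if c \<in> L then 1 else 0))"
  proof (rule sum_mono)
    fix c assume c: "c \<in> colors V C"
    then obtain x y where xy: "x \<in> V" "y \<in> V" "x \<noteq> y" "c = C x y" by (auto simp: colors_iff)
    have "P c \<subseteq> {x, y}" using private_vertices_subset[OF xy(1-3), of C] xy(4) by (simp add: P_def)
    then have "card (P c) \<le> card {x, y}" by (intro card_mono) auto
    then show "card (P c) \<le> 1 + (if c \<in> L then 1 else 0)" using c xy(3) by (auto simp: L_def)
  qed
  also have "\<dots> = card (colors V C) + card (colors V C \<inter> L)"
    using fc by (simp only: sum.distrib) (simp add: sum.If_cases)
  also have "colors V C \<inter> L = L" by (auto simp: L_def)
  finally have "3 \<le> card L" using n col by simp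
  then obtain T where T: "T \<subseteq> L" "card T = 3" using obtain_subset_with_card_n by metis
  then obtain c1 c2 c3 where c: "c1 \<in> L" "c2 \<in> L" "c3 \<in> L" "c1 \<noteq> c2" "c2 \<noteq> c3" "c1 \<noteq> c3"
    by (auto simp: card_3_iff)
  have arc: "\<exists>u v. local_arc V C u v \<and> c = C u v" if "c \<in> L" for c
    using local_arc_of_private[of c V C] that unfolding L_def P_def mem_Collect_eq by metis
  obtain u1 v1 where l1: "local_arc V C u1 v1" "c1 = C u1 v1" using arc[OF c(1)] by blast
  obtain u2 v2 where l2: "local_arc V C u2 v2" "c2 = C u2 v2" using arc[OF c(2)] by blast
  obtain u3 v3 where l3: "local_arc V C u3 v3" "c3 = C u3 v3" using arc[OF c(3)] by blast
  have m: "u1 \<in> V" "v1 \<in> V" "u1 \<noteq> v1" "u2 \<in> V" "v2 \<in> V" "u2 \<noteq> v2" "u3 \<in> V" "v3 \<in> V" "u3 \<noteq> v3"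
    using l1 l2 l3 by (auto simp: local_arc_def)
  have "{u1, v1} \<inter> {u2, v2} \<noteq> {} \<or> {u1, v1} \<inter> {u3, v3} \<noteq> {} \<or> {u2, v2} \<inter> {u3, v3} \<noteq> {}"
  proof (rule ccontr)
    assume "\<not> ?thesis"
    then have "card {u1, v1, u2, v2, u3, v3} = 6" using m by auto
    moreover have "card {u1, v1, u2, v2, u3, v3} \<le> card V" using m fin by (intro card_mono) auto
    ultimately show False using n by simp
  qed
  moreover note two_local_arcs[OF nr n seven del l1(1) l2(1)] two_local_arcs[OF nr n seven del l1(1) l3(1)]
    two_local_arcs[OF nr n seven del l2(1) l3(1)]
  ultimately show ?thesis using c l1 l2 l3 by metis
qed

section \<open>Six and more vertices\<close>

definition balanced_bip :: "'a set \<Rightarrow> ('a \<Rightarrow> 'a \<Rightarrow> nat) \<Rightarrow> bool" where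
  "balanced_bip V C \<longleftrightarrow> (\<exists>A B. A \<union> B = V \<and> A \<inter> B = {} \<and> card A = card V div 2 \<and>
     card B = card V - card V div 2 \<and> bip_structure V A B C)"

lemma balanced_bip_rev: "balanced_bip V (rev_col C) \<Longrightarrow> balanced_bip V C"
  unfolding balanced_bip_def using bip_structure_rev[of V _ _ C] by blast

lemma source_targets:
  assumes nr: "\<not> has_rainbow_triangle V C" and v: "v \<in> V" and fin: "finite V"
  obtains X where "X \<subseteq> V - {v}" "card X = card (out_sat V C v)"
    "\<forall>x y w. x \<in> X \<longrightarrow> y \<in> X \<longrightarrow> x \<noteq> y \<longrightarrow> w \<in> V - {v} \<longrightarrow> w \<noteq> x \<longrightarrow> w \<noteq> y \<longrightarrow>
      C x w = C w v \<and> C y w = C w v"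
proof -
  obtain X where X: "X \<subseteq> V" "v \<notin> X" "inj_on (C v) X" "C v ` X = out_sat V C v" "finite X"
    "card X = card (out_sat V C v)" using out_sat_targets[OF nr v fin] .
  have "C x w = C w v \<and> C y w = C w v"
    if "x \<in> X" "y \<in> X" "x \<noteq> y" "w \<in> V - {v}" "w \<noteq> x" "w \<noteq> y" for x y w
  proof -
    have ne: "C v x \<noteq> C v y" using X(3) that by (metis inj_onD)
    have s: "C v x \<in> sat V C v" "C v y \<in> sat V C v" using X(4) that(1,2) by (auto simp: out_sat_def)
    have m: "x \<in> V" "y \<in> V" "w \<in> V" "x \<noteq> v" "y \<noteq> v" "w \<noteq> v" using that X(1,2) by auto
    show ?thesis
      using sat_two_out[OF nr v m(1,2,3,4,5,6) that(5,6) s ne]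
        sat_two_out[OF nr v m(2,1,3,5,4,6) that(6,5) s(2,1) ne[symmetric]] by simp
  qed
  then show ?thesis using that[of X] X by auto
qed

text \<open>Targets of \<open>v\<close> look alike from other vertices of \<open>V - {v}\<close>.
  Two of them would lie in any four vertices with six colours, against
  \<open>four_vertices_separate\<close>. In Type III either two lie in \<open>B\<close>, against
  \<open>three_vertices_separate\<close>, or two lie in \<open>A\<close> and one in
  \<open>B\<close>, which puts \<open>g\<close> inside \<open>A\<close>. Only Type II
  survives.\<close>

lemma six_vertices_source:
  assumes nr: "\<not> has_rainbow_triangle V C" and n: "card V = 6" and v: "v \<in> V"
    and three: "3 \<le> card (out_sat V C v)" and seven: "7 \<le> card (colors (V - {v}) C)"
  shows "balanced_bip (V - {v}) C"
proof -
  have fin: "finite V" using n card.infinite by fastforce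
  let ?U = "V - {v}"
  have nrU: "\<not> has_rainbow_triangle ?U C" by (rule no_rainbow_mono[OF nr]) auto
  have cU: "card ?U = 5" using n v fin by simp
  obtain X where X: "X \<subseteq> ?U" "card X = card (out_sat V C v)"
    and com0: "\<forall>x y w. x \<in> X \<longrightarrow> y \<in> X \<longrightarrow> x \<noteq> y \<longrightarrow> w \<in> ?U \<longrightarrow> w \<noteq> x \<longrightarrow> w \<noteq> y \<longrightarrow>
      C x w = C w v \<and> C y w = C w v"
    using source_targets[OF nr v fin] .
  note com = com0[rule_format]
  have finX: "finite X" using X fin finite_subset by blast
  have del: "card (colors (?U - {w}) C) \<le> 5" if w: "w \<in> ?U" for w
  proof (rule ccontr)
    assume "\<not> ?thesis"
    then have six: "6 \<le> card (colors (?U - {w}) C)" by simp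
    have nrw: "\<not> has_rainbow_triangle (?U - {w}) C" by (rule no_rainbow_mono[OF nrU]) auto
    have cw: "card (?U - {w}) = 4" using cU w fin by simp
    have "2 \<le> card (X - {w})" using three X(2) diff_card_le_card_Diff[of "{w}" X] by simp
    then obtain x y where xy: "x \<in> X - {w}" "y \<in> X - {w}" "x \<noteq> y" using ex_two_elements by metis
    then obtain z where "z \<in> ?U - {w}" "z \<noteq> x" "z \<noteq> y" "C x z \<noteq> C y z"
      using four_vertices_separate(1)[OF nrw cw six, of x y] X(1) by blast
    then show False using com[of x y z] xy by auto
  qed
  have "\<not> type3_structure ?U C"
  proof
    assume "type3_structure ?U C"
    then obtain A B g where AB: "A \<union> B = ?U" "A \<inter> B = {}" "card A = 2" "card B = 3"
      "card (colors B C) = 4" "g \<notin> colors A C \<union> colors B C"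
      and g: "\<And>x y. x \<in> A \<Longrightarrow> y \<in> B \<Longrightarrow> C x y = g \<and> C y x = g"
      unfolding type3_structure_def by blast
    have finAB: "finite A" "finite B" using AB card.infinite by fastforce+
    have nrB: "\<not> has_rainbow_triangle B C" by (rule no_rainbow_mono[OF nrU]) (use AB(1) in auto)
    show False
    proof (cases "2 \<le> card (X \<inter> B)")
      case True
      then obtain x y where xy: "x \<in> X \<inter> B" "y \<in> X \<inter> B" "x \<noteq> y" using ex_two_elements by metis
      have "0 < card (B - {x, y})" using AB(4) xy finAB by (simp add: card_Diff_subset)
      then obtain w where w: "w \<in> B" "w \<noteq> x" "w \<noteq> y" by (metis Diff_iff card_gt_0_iff ex_in_conv insertCI)
      have "C x w \<noteq> C y w" using three_vertices_separate(1)[OF nrB AB(4), of x y w] AB(5) xy w by auto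
      moreover have "w \<in> ?U" using w AB(1) by blast
      ultimately show False using com[of x y w] xy w by simp
    next
      case False
      have "X = (X \<inter> A) \<union> (X \<inter> B)" using X(1) AB(1) by auto
      then have "card X \<le> card (X \<inter> A) + card (X \<inter> B)" by (metis card_Un_le)
      moreover have "card (X \<inter> A) \<le> 2" using card_mono[OF finAB(1), of "X \<inter> A"] AB(3) by auto
      ultimately have "2 \<le> card (X \<inter> A)" "1 \<le> card (X \<inter> B)" using False three X(2) by linarith+
      then obtain a1 a2 b where ab: "a1 \<in> X \<inter> A" "a2 \<in> X \<inter> A" "a1 \<noteq> a2" "b \<in> X \<inter> B"
        using ex_two_elements[of "X \<inter> A"] by (metis card.empty ex_in_conv not_one_le_zero)
      have "a1 \<in> ?U" "a2 \<noteq> b" "a1 \<noteq> b" using ab AB(1,2) by blast+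
      then have "C a2 a1 = C b a1" using com[of a2 b a1] ab by simp
      also have "\<dots> = g" using g ab by auto
      finally show False using AB(6) colorsI[of a2 A a1 C] ab by auto
    qed
  qed
  then have "type2_structure ?U C" using five_vertices[OF nrU cU seven del] by blast
  then show ?thesis unfolding type2_structure_def balanced_bip_def cU by simp
qed

text \<open>Renaming the parts so that the rainbow arcs run from \<open>P\<close> to
  \<open>Q\<close> removes the choice of direction but leaves open which part is smaller.\<close>

lemma bip_structure_directed:
  assumes "bip_structure V A B C" "A \<union> B = V" "A \<inter> B = {}"
  obtains P Q g where "P = A \<and> Q = B \<or> P = B \<and> Q = A" "rainbow (P \<times> Q) C"
    "\<forall>p\<in>P. \<forall>q\<in>Q. C p q \<noteq> g"
    "\<forall>x\<in>V. \<forall>y\<in>V. x \<noteq> y \<longrightarrow> \<not> (x \<in> P \<and> y \<in> Q) \<longrightarrow> C x y = g"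
proof -
  obtain H c where H: "H = A \<times> B \<or> H = B \<times> A" "rainbow H C" and
    c: "\<forall>(x, y) \<in> arcs V - H. C x y = c" "c \<notin> (\<lambda>(x, y). C x y) ` H"
    using assms(1) unfolding bip_structure_def by blast
  from H(1) obtain P Q where PQ: "P = A \<and> Q = B \<or> P = B \<and> Q = A" "H = P \<times> Q" by blast
  show ?thesis
    by (rule that[of P Q c]) (use H PQ c in \<open>auto simp: arcs_def image_iff\<close>)
qed

text \<open>The product is the floor of \<open>n^2 / 4\<close>; its increment is exactly the number
  of saturated colours allowed by \<open>ex_small_sat\<close>.\<close>

lemma div2_product_step:
  fixes n :: nat
  assumes "1 \<le> n"
  shows "n div 2 * (n - n div 2) = (n - 1) div 2 * (n - 1 - (n - 1) div 2) + n div 2"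
proof (cases "even n")
  case True
  then obtain k where k: "n = 2 * k" by blast
  then obtain j where "k = Suc j" using assms by (cases k) auto
  then show ?thesis using k by simp
next
  case False
  then obtain k where "n = 2 * k + 1" using oddE by blast
  then show ?thesis by simp
qed

text \<open>A target in \<open>P\<close> would be told apart from any other target by its arcs into
  \<open>Q\<close>, so all targets lie in \<open>Q\<close>. Sizes make the targets exactly
  \<open>Q\<close>, and \<open>v\<close> joins \<open>P\<close>; \<open>bip_structureI\<close>
  settles the arcs from \<open>v\<close> to \<open>Q\<close> by counting.\<close>

lemma balanced_bip_extend:
  assumes nr: "\<not> has_rainbow_triangle V C" and n: "6 \<le> card V" and v: "v \<in> V"
    and src: "card V div 2 \<le> card (out_sat V C v)"
    and cols: "card V div 2 * (card V - card V div 2) + 1 \<le> card (colors V C)"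
    and bip: "balanced_bip (V - {v}) C"
  shows "balanced_bip V C"
proof -
  have fin: "finite V" using n card.infinite by fastforce
  let ?U = "V - {v}" and ?k = "card V div 2"
  have cU: "card ?U = card V - 1" using v fin by simp
  have k3: "3 \<le> ?k" using n by linarith
  obtain A B where AB: "A \<union> B = ?U" "A \<inter> B = {}" "card A = card ?U div 2"
    "card B = card ?U - card ?U div 2" "bip_structure ?U A B C"
    using bip unfolding balanced_bip_def by blast
  obtain P Q g where PQ: "P = A \<and> Q = B \<or> P = B \<and> Q = A" "rainbow (P \<times> Q) C"
    and ng0: "\<forall>p\<in>P. \<forall>q\<in>Q. C p q \<noteq> g"
    and g0: "\<forall>x\<in>?U. \<forall>y\<in>?U. x \<noteq> y \<longrightarrow> \<not> (x \<in> P \<and> y \<in> Q) \<longrightarrow> C x y = g"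
    using bip_structure_directed[OF AB(5,1,2)] .
  note ng = ng0[rule_format] and g = g0[rule_format]
  have U: "P \<union> Q = ?U" "P \<inter> Q = {}" using PQ(1) AB(1,2) by auto
  have finPQ: "finite P" "finite Q" using U(1) fin by (metis finite_Diff finite_Un)+
  have "2 \<le> card ?U div 2" using n cU by linarith
  then have Q2: "2 \<le> card Q" using PQ(1) AB(3,4) by auto
  have inj: "C p q \<noteq> C p' q'" if "p \<in> P" "q \<in> Q" "p' \<in> P" "q' \<in> Q" "p \<noteq> p' \<or> q \<noteq> q'" for p q p' q'
    using PQ(2) that unfolding rainbow_def inj_on_def by auto
  obtain X where X: "X \<subseteq> ?U" "card X = card (out_sat V C v)"
    and com0: "\<forall>x y w. x \<in> X \<longrightarrow> y \<in> X \<longrightarrow> x \<noteq> y \<longrightarrow> w \<in> ?U \<longrightarrow> w \<noteq> x \<longrightarrow> w \<noteq> y \<longrightarrow>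
      C x w = C w v \<and> C y w = C w v"
    using source_targets[OF nr v fin] .
  note com = com0[rule_format]
  have other: "\<exists>q\<in>Q. q \<noteq> y" for y
  proof -
    have "0 < card (Q - {y})" using Q2 diff_card_le_card_Diff[of "{y}" Q] by simp
    then show ?thesis by (metis DiffD1 DiffD2 card_gt_0_iff ex_in_conv singletonI)
  qed
  have X2: "\<exists>y\<in>X. y \<noteq> x \<and> y \<noteq> z" for x z
  proof -
    have "card X - card {x, z} \<le> card (X - {x, z})" by (rule diff_card_le_card_Diff) simp
    moreover have "card {x, z} \<le> 2" by (simp add: card_insert_if)
    ultimately have "0 < card (X - {x, z})" using X(2) src k3 by linarith
    then show ?thesis by (metis Diff_iff card_gt_0_iff ex_in_conv insertCI)
  qed
  have XQ: "X \<subseteq> Q"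
  proof
    fix x assume x: "x \<in> X"
    show "x \<in> Q"
    proof (rule ccontr)
      assume "x \<notin> Q"
      then have xP: "x \<in> P" using x X(1) U(1) by auto
      obtain y where y: "y \<in> X" "y \<noteq> x" using X2 by metis
      obtain w where w: "w \<in> Q" "w \<noteq> y" using other by metis
      have wU: "w \<in> ?U" "w \<noteq> x" using w xP U by auto
      have eq: "C x w = C y w" using com[of x y w] x y w wU by simp
      show False
      proof (cases "y \<in> P")
        case True
        then show False using inj[of x w y w] xP w y eq by auto
      next
        case False
        then have "C y w = g" using g[of y w] y w wU X(1) by auto
        then show False using ng[OF xP w(1)] eq by simp
      qed
    qed
  qed
  \<comment> \<open>Even the larger part of \<open>card V - 1\<close> vertices has only
    \<open>card V div 2\<close> elements.\<close>
  have "card Q \<le> ?k" using PQ(1) AB(3,4) cU n by auto linarith+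
  then have XeqQ: "X = Q" and cQ: "card Q = ?k"
    using card_seteq[OF finPQ(2) XQ] card_mono[OF finPQ(2) XQ] X(2) src by simp_all
  have "card P + card Q = card ?U" using U finPQ card_Un_disjoint by metis
  moreover have vPQ: "v \<notin> P" "v \<notin> Q" using U(1) by blast+
  then have "card (insert v P) = Suc (card P)" using finPQ by simp
  ultimately have cP: "card (insert v P) = card V - ?k" using cQ cU n by linarith
  \<comment> \<open>A target \<open>x\<close> other than \<open>w\<close> lies in \<open>Q\<close>,
    so \<open>x w\<close> has the background colour, and the presence of a further target gives
    \<open>w v\<close> the same colour.\<close>
  have to_v: "C w v = g" if w: "w \<in> ?U" for w
  proof -
    obtain x where x: "x \<in> X" "x \<noteq> w" using X2 by metis
    obtain y where y: "y \<in> X" "y \<noteq> x" "y \<noteq> w" using X2 by metis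
    have "C x w = C w v" using com[of x y w] x y w by simp
    moreover have "C x w = g" using g[of x w] x w X(1) XQ U(2) by blast
    ultimately show ?thesis by simp
  qed
  \<comment> \<open>Since \<open>q v\<close> has colour \<open>g\<close>, another colour on
    \<open>v w\<close> would equal that of \<open>w q\<close> for every \<open>q\<close> in
    \<open>Q\<close>; two such \<open>q\<close> contradict the rainbow property.\<close>
  have from_v: "C v w = g" if w: "w \<in> P" for w
  proof (rule ccontr)
    assume ne: "C v w \<noteq> g"
    have wU: "w \<in> V" "w \<noteq> v" using w U(1) by blast+
    have "C v w = C w q" if q: "q \<in> Q" for q
    proof -
      have qU: "q \<in> V" "q \<noteq> v" "q \<noteq> w" using q w U by blast+
      then show ?thesis
        using no_rainbowD[OF nr v wU(1) qU(1)] wU to_v[of q] ne ng[OF w q] by auto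
    qed
    moreover obtain q1 where q1: "q1 \<in> Q" using other by metis
    moreover obtain q2 where "q2 \<in> Q" "q2 \<noteq> q1" using other by metis
    ultimately show False using inj[of w q1 w q2] w by metis
  qed
  have part: "Q \<union> insert v P = V" "insert v P \<union> Q = V" "Q \<inter> insert v P = {}" "insert v P \<inter> Q = {}"
    using U v vPQ by blast+
  have "bip_structure V Q (insert v P) C"
  proof (rule bip_structureI(2)[where g = g])
    fix x y assume xy: "x \<in> V" "y \<in> V" "x \<noteq> y" "\<not> (x \<in> insert v P \<and> y \<in> Q)"
    show "C x y = g"
    proof (cases "y = v")
      case True
      then show ?thesis using to_v[of x] xy by auto
    next
      case yv: False
      show ?thesis
      proof (cases "x = v")
        case True
        then have "y \<in> P" using xy yv U(1) by blast
        then show ?thesis using from_v True by simp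
      next
        case False
        then show ?thesis using g[of x y] xy yv by auto
      qed
    qed
  qed (use finPQ part cols cP cQ in \<open>auto simp: mult.commute\<close>)
  then show ?thesis unfolding balanced_bip_def using cP cQ part by blast
qed

text \<open>Bound and structure share one induction, because equality on \<open>Suc m\<close>
  vertices calls for the structure on \<open>m\<close>. Equality forces the chosen vertex to
  saturate exactly \<open>Suc m div 2\<close> colours and the rest to be extremal.\<close>

lemma card_colors_large:
  assumes "5 \<le> n" "card V = n" "\<not> has_rainbow_triangle V C"
  shows "card (colors V C) \<le> n div 2 * (n - n div 2) + 1 \<and>
    (6 \<le> n \<longrightarrow> n div 2 * (n - n div 2) + 1 \<le> card (colors V C) \<longrightarrow> balanced_bip V C)"
  using assms
proof (induction n arbitrary: V C rule: nat_induct_at_least)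
  case base
  then show ?case using card_colors_five[of V C] by simp
next
  case (Suc m)
  have n: "card V = Suc m" and nr: "\<not> has_rainbow_triangle V C" and m: "5 \<le> m" using Suc by auto
  have fin: "finite V" using n card.infinite by fastforce
  let ?k = "Suc m div 2"
  have step: "?k * (Suc m - ?k) = m div 2 * (m - m div 2) + ?k" using div2_product_step[of "Suc m"] by simp
  obtain v where v: "v \<in> V" "card (sat V C v) \<le> ?k" using ex_small_sat[OF nr fin] n m by auto
  have cU: "card (V - {v}) = m" using n v fin by simp
  have nrU: "\<not> has_rainbow_triangle (V - {v}) C" by (rule no_rainbow_mono[OF nr]) auto
  have colU: "card (colors (V - {v}) C) \<le> m div 2 * (m - m div 2) + 1" using Suc.IH[OF cU nrU] by simp
  have del: "card (colors V C) = card (colors (V - {v}) C) + card (sat V C v)"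
    using card_colors_delete[OF fin] .
  have "balanced_bip V C" if ge: "?k * (Suc m - ?k) + 1 \<le> card (colors V C)"
  proof -
    have satk: "?k \<le> card (sat V C v)" and full: "m div 2 * (m - m div 2) + 1 \<le> card (colors (V - {v}) C)"
      using ge step colU del v(2) by linarith+
    \<comment> \<open>Only colour sets that reversal preserves are assumed of \<open>C'\<close>, so
      sinks are covered by \<open>rev_col C\<close>.\<close>
    have source: "balanced_bip V C'"
      if C': "\<not> has_rainbow_triangle V C'" "colors V C' = colors V C"
        "colors (V - {v}) C' = colors (V - {v}) C"
        "?k \<le> card (out_sat V C' v)" for C'
    proof (rule balanced_bip_extend[OF C'(1) _ v(1)])
      have nrU': "\<not> has_rainbow_triangle (V - {v}) C'" by (rule no_rainbow_mono[OF C'(1)]) auto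
      show "balanced_bip (V - {v}) C'"
      proof (cases "6 \<le> m")
        case True
        then show ?thesis using Suc.IH[OF cU nrU'] full C'(3) by simp
      next
        case False
        \<comment> \<open>An extremal colouring of five vertices need not be bipartite; the three
          saturated out-arcs at \<open>v\<close> single out that type.\<close>
        then have "m = 5" using m by simp
        then show ?thesis using six_vertices_source[OF C'(1) _ v(1)] n C' full by simp
      qed
    qed (use n m C' ge in auto)
    have "3 \<le> card (sat V C v)" using satk m by linarith
    then consider "sat V C v = out_sat V C v" | "sat V C v = out_sat V (rev_col C) v"
      using sat_source_or_sink[OF nr v(1) fin] by blast
    then show ?thesis
    proof cases
      case 1
      then show ?thesis using source[of C] nr satk by simp
    next
      case 2
      then have "balanced_bip V (rev_col C)" using source[of "rev_col C"] nr satk by simp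
      then show ?thesis by (rule balanced_bip_rev)
    qed
  qed
  then show ?case using colU del v(2) step by linarith
qed

section \<open>The extremal numbers and the theorem\<close>

lemma f_K_eqI:
  fixes W :: "nat \<Rightarrow> nat \<Rightarrow> nat"
  assumes bound: "\<And>C :: nat \<Rightarrow> nat \<Rightarrow> nat. \<not> has_rainbow_triangle {..<n} C \<Longrightarrow> card (colors {..<n} C) \<le> m"
    and W: "\<not> has_rainbow_triangle {..<n} W" "m \<le> card (colors {..<n} W)"
  shows "f_K n = m + 1"
  unfolding f_K_def
proof (rule Least_equality)
  show "\<forall>C :: nat \<Rightarrow> nat \<Rightarrow> nat. m + 1 \<le> card (colors {..<n} C) \<longrightarrow> has_rainbow_triangle {..<n} C"
    using bound by fastforce
next
  fix k assume "\<forall>C :: nat \<Rightarrow> nat \<Rightarrow> nat. k \<le> card (colors {..<n} C) \<longrightarrow> has_rainbow_triangle {..<n} C"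
  then have "\<not> k \<le> card (colors {..<n} W)" using W(1) by blast
  then show "m + 1 \<le> k" using W(2) by simp
qed

lemma f_K_3: "f_K 3 = 5"
proof -
  \<comment> \<open>The triangle \<open>0 1 2\<close> receives the colours 0, 0, 1 and its reverse
    \<open>0 2 1\<close> receives 2, 2, 3.\<close>
  define W :: "nat \<Rightarrow> nat \<Rightarrow> nat" where
    "W x y = (if (x, y) = (2, 0) then 1 else if (x, y) = (1, 0) then 3 else
       if (x, y) = (0, 2) \<or> (x, y) = (2, 1) then 2 else 0)" for x y
  have V: "{..<3} = {0, 1, 2 :: nat}" by auto
  have "\<not> has_rainbow_triangle {..<3} W"
    unfolding has_rainbow_triangle_def V W_def by auto
  moreover have "card (colors {..<3} W) = 4"
    unfolding V by (subst colors_triple) (auto simp: W_def card_insert_if)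
  ultimately have "f_K 3 = 4 + 1" by (intro f_K_eqI[of 3 4 W] card_colors_three) auto
  then show ?thesis by simp
qed

lemma f_K_4: "f_K 4 = 7"
proof -
  \<comment> \<open>Colours 0 and 1 run along the two opposite four-cycles. Each vertex is the tail
    of one diagonal arc, so \<open>2 + x\<close> separates the diagonals.\<close>
  define W :: "nat \<Rightarrow> nat \<Rightarrow> nat" where
    "W x y = (if y = Suc x mod 4 then 0 else if x = Suc y mod 4 then 1 else 2 + x)" for x y
  have "\<forall>x\<in>{0, 1, 2, 3}. \<forall>y\<in>{0, 1, 2, 3}. \<forall>z\<in>{0, 1, 2, 3}. x \<noteq> y \<longrightarrow> y \<noteq> z \<longrightarrow> x \<noteq> z \<longrightarrow>
      W x y = W y z \<or> W y z = W z x \<or> W x y = W z x"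
    by (simp add: W_def)
  moreover have V: "{..<4} = {0, 1, 2, 3 :: nat}" by auto
  ultimately have "\<not> has_rainbow_triangle {..<4} W"
    unfolding has_rainbow_triangle_def V by blast
  moreover have "{W 0 1, W 1 0, W 0 2, W 2 0, W 1 3, W 3 1} \<subseteq> colors {..<4} W"
    unfolding insert_subset by (auto intro!: colorsI)
  then have "card {W 0 1, W 1 0, W 0 2, W 2 0, W 1 3, W 3 1} \<le> card (colors {..<4} W)"
    by (intro card_mono finite_colors) auto
  then have "6 \<le> card (colors {..<4} W)" by (simp add: W_def)
  ultimately have "f_K 4 = 6 + 1" by (intro f_K_eqI[of 4 6 W] card_colors_four) auto
  then show ?thesis by simp
qed

lemma f_K_large:
  assumes n: "5 \<le> n"
  shows "f_K n = n div 2 * (n - n div 2) + 2"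
proof -
  let ?k = "n div 2"
  \<comment> \<open>The number \<open>x * n + y\<close> encodes the arc in base \<open>n\<close>,
    and adding 1 reserves 0 for the background colour.\<close>
  define W :: "nat \<Rightarrow> nat \<Rightarrow> nat" where
    "W x y = (if x < ?k \<and> ?k \<le> y then 1 + (x * n + y) else 0)" for x y
  \<comment> \<open>A directed triangle passes from the first part to the second at most once, so at
    least two of its arcs have colour 0.\<close>
  have nr: "\<not> has_rainbow_triangle {..<n} W"
    unfolding has_rainbow_triangle_def W_def by auto
  have inj: "inj_on (\<lambda>(x, y). x * n + y + 1) ({..<?k} \<times> {?k..<n})"
  proof (rule inj_onI, clarify)
    fix x y x' y' assume "y \<in> {?k..<n}" "y' \<in> {?k..<n}" "x * n + y + 1 = x' * n + y' + 1"
    then have "(x * n + y) div n = (x' * n + y') div n" "(x * n + y) mod n = (x' * n + y') mod n"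
      "y < n" "y' < n" by auto
    then show "x = x' \<and> y = y'" by simp
  qed
  let ?I = "(\<lambda>(x, y). x * n + y + 1) ` ({..<?k} \<times> {?k..<n})"
  have "insert 0 ?I \<subseteq> colors {..<n} W"
  proof (intro insert_subsetI subsetI)
    have "W 1 0 = 0" using n by (simp add: W_def)
    then show "0 \<in> colors {..<n} W" using colorsI[of 1 "{..<n}" 0 W] n by simp
  next
    fix c assume "c \<in> ?I"
    then obtain x y where xy: "x < ?k" "?k \<le> y" "y < n" "c = x * n + y + 1" by auto
    then have "c = W x y" by (simp add: W_def)
    then show "c \<in> colors {..<n} W" using colorsI[of x "{..<n}" y W] xy by simp
  qed
  then have "card (insert 0 ?I) \<le> card (colors {..<n} W)" by (intro card_mono finite_colors) auto
  moreover have "card (insert 0 ?I) = 1 + card ?I" by (subst card_insert_disjoint) auto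
  moreover have "card ?I = ?k * (n - ?k)" using card_image[OF inj] by (simp add: card_cartesian_product)
  ultimately have W: "?k * (n - ?k) + 1 \<le> card (colors {..<n} W)" by simp
  have "f_K n = ?k * (n - ?k) + 1 + 1"
    by (rule f_K_eqI[OF _ nr W]) (use card_colors_large[OF n, of "{..<n}"] in auto)
  then show ?thesis by simp
qed

section \<open>Reading off the types for the classes \<open>in_G\<close>\<close>

lemma in_G_5_cases:
  assumes "in_G 5 V C"
  shows "(\<exists>v \<in> V. \<exists>c. (\<forall>u \<in> V - {v}. C v u = c \<and> C u v = c) \<and>
           in_G 4 (V - {v}) C \<and> c \<notin> colors (V - {v}) C) \<or> type2_structure V C \<or> type3_structure V C"
proof (cases "\<exists>v\<in>V. 6 \<le> card (colors (V - {v}) C)")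
  case True
  have V: "finite V" "card V = 5" "7 \<le> card (colors V C)" "\<not> has_rainbow_triangle V C"
    using assms f_K_large[of 5] by (auto simp: in_G_def)
  from True obtain v where v: "v \<in> V" "6 \<le> card (colors (V - {v}) C)" by blast
  have nrv: "\<not> has_rainbow_triangle (V - {v}) C" by (rule no_rainbow_mono[OF V(4)]) auto
  have cv: "card (V - {v}) = 4" using V v by simp
  have "in_G 4 (V - {v}) C"
    unfolding in_G_def f_K_4 using nrv cv V(1) v(2) card_colors_four[OF nrv cv] by simp
  then show ?thesis using five_vertices_type1[OF V(4,2) v V(3)] v(1) by blast
next
  case False
  then have "card (colors (V - {w}) C) \<le> 5" if "w \<in> V" for w using that by force
  then show ?thesis using five_vertices[of V C] assms f_K_large[of 5] by (simp add: in_G_def)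
qed

lemma type3_structure_letters:
  assumes nr: "\<not> has_rainbow_triangle V C" and t: "type3_structure V C"
  shows "\<exists>A B. A \<union> B = V \<and> A \<inter> B = {} \<and> card A = 2 \<and> card B = 3 \<and>
          (\<exists>a b c d e f g. distinct [a, b, c, d, e, f, g] \<and>
             colors A C = {a, b} \<and> in_G 3 B C \<and> colors B C = {c, d, e, f} \<and>
             (\<forall>x \<in> A. \<forall>y \<in> B. C x y = g \<and> C y x = g))"
proof -
  obtain A B g where AB: "A \<union> B = V" "A \<inter> B = {}" "card A = 2" "card B = 3"
    "card (colors A C) = 2" "card (colors B C) = 4" "colors A C \<inter> colors B C = {}"
    "g \<notin> colors A C \<union> colors B C" and g: "\<forall>x\<in>A. \<forall>y\<in>B. C x y = g \<and> C y x = g"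
    using t unfolding type3_structure_def by blast
  have nrB: "\<not> has_rainbow_triangle B C" by (rule no_rainbow_mono[OF nr]) (use AB(1) in blast)
  have finB: "finite B" using AB(4) card.infinite by fastforce
  have G: "in_G 3 B C" unfolding in_G_def f_K_3 using finB nrB AB(4,6) by simp
  obtain a b where ab: "colors A C = {a, b}" "a \<noteq> b" using AB(5) by (meson card_2_iff)
  obtain c R where c: "colors B C = insert c R" "c \<notin> R" "card R = 3"
    using AB(6) card_Suc_eq[of "colors B C" 3] by auto
  obtain d e f where R: "R = {d, e, f}" "d \<noteq> e" "e \<noteq> f" "d \<noteq> f" using c(3) by (metis card_3_iff)
  have B: "colors B C = {c, d, e, f}" using c R by simp
  have d: "distinct [a, b, c, d, e, f, g]" using AB(7,8) ab c(2) R B by auto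
  show ?thesis
    by (rule exI[of _ A], rule exI[of _ B], intro conjI AB(1-4), rule exI[of _ a], rule exI[of _ b],
        rule exI[of _ c], rule exI[of _ d], rule exI[of _ e], rule exI[of _ f], rule exI[of _ g])
      (intro conjI d ab(1) G B g)
qed

theorem theorem2:
  fixes C :: "'a \<Rightarrow> 'a \<Rightarrow> nat"
  shows
  "(\<forall>V. in_G 3 V C \<longrightarrow>
      (\<exists>x y z. V = {x, y, z} \<and> x \<noteq> y \<and> y \<noteq> z \<and> x \<noteq> z \<and>
         card {C x y, C y z, C z x} = 2 \<and> card {C x z, C z y, C y x} = 2 \<and>
         {C x y, C y z, C z x} \<inter> {C x z, C z y, C y x} = {}))
   \<and>
   (\<forall>V. in_G 4 V C \<longrightarrow>
      (\<exists>v1 v2 v3 v4. V = {v1, v2, v3, v4} \<and> distinct [v1, v2, v3, v4] \<and>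
         (\<exists>a b c d e f. distinct [a, b, c, d, e, f] \<and>
            C v1 v2 = a \<and> C v2 v3 = a \<and> C v3 v4 = a \<and> C v4 v1 = a \<and>
            C v1 v4 = b \<and> C v4 v3 = b \<and> C v3 v2 = b \<and> C v2 v1 = b \<and>
            C v1 v3 = c \<and> C v3 v1 = d \<and> C v2 v4 = e \<and> C v4 v2 = f)))
   \<and>
   (\<forall>V. in_G 5 V C \<longrightarrow>
      ((\<exists>v \<in> V. \<exists>c. (\<forall>u \<in> V - {v}. C v u = c \<and> C u v = c) \<and>
           in_G 4 (V - {v}) C \<and> c \<notin> colors (V - {v}) C)
       \<or>
       (\<exists>A B. A \<union> B = V \<and> A \<inter> B = {} \<and> card A = 2 \<and> card B = 3 \<and>
           bip_structure V A B C)
       \<or>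
       (\<exists>A B. A \<union> B = V \<and> A \<inter> B = {} \<and> card A = 2 \<and> card B = 3 \<and>
          (\<exists>a b c d e f g. distinct [a, b, c, d, e, f, g] \<and>
             colors A C = {a, b} \<and> in_G 3 B C \<and> colors B C = {c, d, e, f} \<and>
             (\<forall>x \<in> A. \<forall>y \<in> B. C x y = g \<and> C y x = g)))))
   \<and>
   (\<forall>n V. 6 \<le> n \<longrightarrow> in_G n V C \<longrightarrow>
      (\<exists>A B. A \<union> B = V \<and> A \<inter> B = {} \<and> card A = n div 2 \<and> card B = n - n div 2 \<and>
         bip_structure V A B C))"
proof (intro conjI allI impI)
  fix V assume G: "in_G 3 V C"
  then have V: "card V = 3" "4 \<le> card (colors V C)" "\<not> has_rainbow_triangle V C"
    using f_K_3 by (auto simp: in_G_def)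
  obtain x y z where xyz: "V = {x, y, z}" "x \<noteq> y" "y \<noteq> z" "x \<noteq> z" using V(1) by (metis card_3_iff)
  then show "\<exists>x y z. V = {x, y, z} \<and> x \<noteq> y \<and> y \<noteq> z \<and> x \<noteq> z \<and>
         card {C x y, C y z, C z x} = 2 \<and> card {C x z, C z y, C y x} = 2 \<and>
         {C x y, C y z, C z x} \<inter> {C x z, C z y, C y x} = {}"
    using three_vertices(2)[of x y z C] V(2,3) by blast
next
  fix V assume G: "in_G 4 V C"
  then have "card V = 4" "6 \<le> card (colors V C)" "\<not> has_rainbow_triangle V C"
    using f_K_4 by (auto simp: in_G_def)
  then obtain v1 v2 v3 v4 where v: "V = {v1, v2, v3, v4} \<and> distinct [v1, v2, v3, v4]"
    "four_cycle_structure C v1 v2 v3 v4" using four_vertices by metis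
  show "\<exists>v1 v2 v3 v4. V = {v1, v2, v3, v4} \<and> distinct [v1, v2, v3, v4] \<and>
         (\<exists>a b c d e f. distinct [a, b, c, d, e, f] \<and>
            C v1 v2 = a \<and> C v2 v3 = a \<and> C v3 v4 = a \<and> C v4 v1 = a \<and>
            C v1 v4 = b \<and> C v4 v3 = b \<and> C v3 v2 = b \<and> C v2 v1 = b \<and>
            C v1 v3 = c \<and> C v3 v1 = d \<and> C v2 v4 = e \<and> C v4 v2 = f)"
    using v unfolding four_cycle_structure_def by blast
next
  fix V assume G: "in_G 5 V C"
  then have nr: "\<not> has_rainbow_triangle V C" by (simp add: in_G_def)
  show "(\<exists>v \<in> V. \<exists>c. (\<forall>u \<in> V - {v}. C v u = c \<and> C u v = c) \<and>
           in_G 4 (V - {v}) C \<and> c \<notin> colors (V - {v}) C)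
       \<or>
       (\<exists>A B. A \<union> B = V \<and> A \<inter> B = {} \<and> card A = 2 \<and> card B = 3 \<and>
           bip_structure V A B C)
       \<or>
       (\<exists>A B. A \<union> B = V \<and> A \<inter> B = {} \<and> card A = 2 \<and> card B = 3 \<and>
          (\<exists>a b c d e f g. distinct [a, b, c, d, e, f, g] \<and>
             colors A C = {a, b} \<and> in_G 3 B C \<and> colors B C = {c, d, e, f} \<and>
             (\<forall>x \<in> A. \<forall>y \<in> B. C x y = g \<and> C y x = g)))"
    using in_G_5_cases[OF G] type3_structure_letters[OF nr] unfolding type2_structure_def by argo
next
  fix n V assume n: "6 \<le> (n :: nat)" and G: "in_G n V C"
  then have "balanced_bip V C"
    using card_colors_large[of n V C] f_K_large[of n] by (simp add: in_G_def)
  then show "\<exists>A B. A \<union> B = V \<and> A \<inter> B = {} \<and> card A = n div 2 \<and> card B = n - n div 2 \<and>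
         bip_structure V A B C"
    using G by (simp add: balanced_bip_def in_G_def)
qed

end
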